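(* Let $j\in I$. Then there is a unique $\mathbb C[q,q^{-1}]$-Hopf algebra automorphism $\mathsf T_j^\Phi$ of $\mathscr U^0_q(L\mathfrak g)$ satisfying $\Phi\circ\mathsf T_j^\Phi=\mathsf T_j\circ\Phi$. It is given explicitly by the formulas $$\mathsf T_j^\Phi(K_i)=K_{s_j(\alpha_i)}=K_iK_j^{-a_{ji}}\qquad\text{and}\qquad\mathsf T_j^\Phi(\mathsf h_{i,r})=\mathsf h_{i,r}-q_j^r\frac{[ra_{ij}]_{q_i}}{[r]_{q_i}}\mathsf h_{j,r}$$ for all $i\in I$ and nonzero $r\in\mathbb Z$.
   Context: $\mathfrak g$ is a simple Lie algebra over $\mathbb C$ with Cartan matrix $(a_{ij})_{i,j\in I}$, simple roots $\alpha_i$, simple reflections $s_i$, minimal symmetrizing integers $d_i$ ($d_ia_{ij}=d_ja_{ji}$). $q_i=q^{d_i}$, $[n]_q=\frac{q^n-q^{-n}}{q-q^{-1}}$. $\mathscr U^0_q(L\mathfrak g)$ is the $\mathbb C[q,q^{-1}]$-subalgebra of the quantum loop algebra $U_q(L\mathfrak g)$ (over $\mathbb C(q)$, in Drinfeld's presentation with generators $K_i^{\pm1},H_{i,r},X^\pm_{i,s}$) generated by $K_i^{\pm1}$ and $\mathsf h_{i,r}=H_{i,r}/[r]_{q_i}$ for $i\in I$, $r\in\mathbb Z\setminus\{0\}$; it is the commutative algebra of polynomials in the $\mathsf h_{i,r}$ and Laurent polynomials in the $K_i$ over $\mathbb C[q,q^{-1}]$. Its (Drinfeld) Hopf structure has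 $K_i$ grouplike and $\mathsf h_{i,r}$ primitive. For $\beta=\sum n_i\alpha_i$, $K_\beta=\prod K_i^{n_i}$. Fix $\hbar\in\mathbb C^\times$. $Y^0=Y^0_\hbar(\mathfrak g)$ is the commutative subalgebra of the Yangian $Y_\hbar(\mathfrak g)$ generated by the $\xi_{i,r}$ ($i\in I,r\ge0$); it is the polynomial algebra in these, filtered by $\deg\xi_{i,r}=r$ with filtration $\mathcal F_nY^0$. Put $\xi_i(u)=1+\hbar\sum_{r\ge0}\xi_{i,r}u^{-r-1}$, $\log\xi_i(u)=\hbar\sum_{r\ge0}t_{i,r}u^{-r-1}$, $\mathcal B_i(u)=\hbar\sum_{r\ge0}t_{i,r}\frac{u^r}{r!}$. The modified braid group operator $\mathsf T_j$ on $Y^0$ is $\Pi\circ\tau_j|_{Y^0}$, where $\tau_j=\exp(\mathrm{ad}\,e_j)\exp(-\mathrm{ad}f_j)\exp(\mathrm{ad}\,e_j)$ on $Y_\hbar(\mathfrak g)\supset U(\mathfrak g)$ and $\Pi:Y_\hbar(\mathfrak g)\to Y^0$ is the projection from the triangular decomposition; explicitly it is the algebra automorphism with $\mathsf T_j(\xi_i(u))=\xi_i(u)\prod_{k=0}^{|a_{ji}|-1}\xi_j\big(u-\frac{\hbar d_j}2(|a_{ji}|-2k)\big)^{(-1)^{\delta_{ij}}}$. It preserves the filtration, and extends $\mathbb C[[v]]$-linearly (coefficientwise in the formal variable $v$) to $\widehat{\mathbb Y^0_v(\mathfrak g)}=\prod_{n\ge0}v^n\mathcal F_nY^0\subset Y^0[[v]]$,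 which is a $\mathbb C[q,q^{-1}]$-algebra via $q\mapsto e^{v/2}$. $\Phi:\mathscr U^0_q(L\mathfrak g)\hookrightarrow\widehat{\mathbb Y^0_v(\mathfrak g)}$ is the embedding of $\mathbb C[q,q^{-1}]$-algebras (restriction of the Gautam–Toledano Laredo homomorphism) determined by $\Phi(K_i)=\exp(\frac v2\xi_{i,0})$ and $\Phi(\mathsf h_{i,r})=\frac{v}{q_i^r-q_i^{-r}}\mathcal B_i(rv/\hbar)$ for $r\ne0$. *)

theory Defs
  imports
    Complex_Main
    "HOL-Library.Poly_Mapping"
    "HOL-Library.Product_Plus"
    "HOL-Computational_Algebra.Formal_Power_Series"
begin

section \<open>Cartan data\<close>

text \<open>
  A simple complex Lie algebra enters only through its Cartan matrix, i.e. through an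
  indecomposable Cartan matrix of finite type.  The finite index set \<open>I\<close> is a
  finite type; \<open>a i j\<close> is the entry \<open>a\<^sub>i\<^sub>j\<close>.
\<close>

definition symmetrizer :: "('i::finite \<Rightarrow> 'i \<Rightarrow> int) \<Rightarrow> ('i \<Rightarrow> nat) \<Rightarrow> bool" where
  "symmetrizer a d \<longleftrightarrow>
     (\<forall>i. d i > 0) \<and> (\<forall>i j. int (d i) * a i j = int (d j) * a j i)"

definition minimal_symmetrizer :: "('i::finite \<Rightarrow> 'i \<Rightarrow> int) \<Rightarrow> ('i \<Rightarrow> nat) \<Rightarrow> bool" where
  "minimal_symmetrizer a d \<longleftrightarrow>
     symmetrizer a d \<and> (\<forall>d'. symmetrizer a d' \<longrightarrow> (\<forall>i. d i \<le> d' i))"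

definition simple_cartan_matrix :: "('i::finite \<Rightarrow> 'i \<Rightarrow> int) \<Rightarrow> bool" where
  "simple_cartan_matrix a \<longleftrightarrow>
     (\<forall>i. a i i = 2) \<and>
     (\<forall>i j. i \<noteq> j \<longrightarrow> a i j \<le> 0) \<and>
     (\<forall>i j. a i j = 0 \<longleftrightarrow> a j i = 0) \<and>
     (\<exists>d. symmetrizer a d \<and>
        (\<forall>x :: 'i \<Rightarrow> real. (\<exists>i. x i \<noteq> 0) \<longrightarrow>
           (\<Sum>i\<in>UNIV. \<Sum>j\<in>UNIV. real (d i) * of_int (a i j) * x i * x j) > 0)) \<and>
     (\<forall>J. J \<noteq> {} \<and> J \<noteq> UNIV \<longrightarrow> (\<exists>i\<in>J. \<exists>j\<in>-J. a i j \<noteq> 0))"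

type_synonym 'i root_lattice = "'i \<Rightarrow>\<^sub>0 int"

definition simple_root :: "'i \<Rightarrow> 'i root_lattice" where
  "simple_root i = Poly_Mapping.single i 1"

definition simple_reflection ::
    "('i::finite \<Rightarrow> 'i \<Rightarrow> int) \<Rightarrow> 'i \<Rightarrow> 'i root_lattice \<Rightarrow> 'i root_lattice" where
  "simple_reflection a j \<beta> =
     \<beta> - Poly_Mapping.single j (\<Sum>i\<in>UNIV. Poly_Mapping.lookup \<beta> i * a j i)"


section \<open>The ring $\mathbb C[q,q^{-1}]$ and quantum integers\<close>

type_synonym laurent = "int \<Rightarrow>\<^sub>0 complex"

definition qpow :: "int \<Rightarrow> laurent" where
  "qpow n = Poly_Mapping.single n 1"

text \<open>
  The quotient \<open>x / y\<close>, for \<open>y \<noteq> 0\<close> dividing \<open>x\<close> in the integral domain of Laurent polynomials.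
\<close>

definition exact_quot :: "laurent \<Rightarrow> laurent \<Rightarrow> laurent" where
  "exact_quot x y = (THE z. z * y = x)"

text \<open>\<open>qint m n\<close> is the quantum integer \<open>[n]\<close> at \<open>q\<^sup>m\<close>; thus \<open>[n]\<close> at \<open>q\<^sub>i\<close> is \<open>qint (d i) n\<close>.\<close>

definition qint :: "int \<Rightarrow> int \<Rightarrow> laurent" where
  "qint m n = exact_quot (qpow (m * n) - qpow (- (m * n))) (qpow m - qpow (- m))"


section \<open>The Hopf algebra $\mathscr U^0_q(L\mathfrak g)$\<close>

typedef nzint = "{r :: int. r \<noteq> 0}" morphisms int_of_nzint nzint_of_int
  by (rule exI[of _ 1]) simp

text \<open>
  Laurent polynomials in the \<open>K\<^sub>i\<close> and polynomials in the \<open>h\<^sub>i\<^sub>,\<^sub>r\<close> (\<open>r \<noteq> 0\<close>), as the monoid algebra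
  over $\mathbb C[q,q^{-1}]$ of the monoid of exponents.
\<close>

type_synonym 'i U0_mon = "('i \<Rightarrow>\<^sub>0 int) \<times> (('i \<times> nzint) \<Rightarrow>\<^sub>0 nat)"
type_synonym 'i U0 = "'i U0_mon \<Rightarrow>\<^sub>0 laurent"

definition U0_scalar :: "laurent \<Rightarrow> 'i U0" where
  "U0_scalar c = Poly_Mapping.single 0 c"

text \<open>\<open>U0_K i n\<close> is the power \<open>K\<^sub>i\<^sup>n\<close>, with \<open>n\<close> any integer.\<close>

definition U0_K :: "'i \<Rightarrow> int \<Rightarrow> 'i U0" where
  "U0_K i n = Poly_Mapping.single (Poly_Mapping.single i n, 0) 1"

definition U0_h :: "'i \<Rightarrow> nzint \<Rightarrow> 'i U0" where
  "U0_h i r = Poly_Mapping.single (0, Poly_Mapping.single (i, r) 1) 1"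

definition U0_K_root :: "('i::finite) root_lattice \<Rightarrow> 'i U0" where
  "U0_K_root \<beta> = (\<Prod>i\<in>UNIV. U0_K i (Poly_Mapping.lookup \<beta> i))"

text \<open>
  \<open>U0_eval \<phi> k k' h\<close> is the ring homomorphism which is \<open>\<phi>\<close> on scalars and maps \<open>K\<^sub>i\<close> to \<open>k i\<close>,
  \<open>K\<^sub>i\<^sup>-\<^sup>1\<close> to \<open>k' i\<close> and \<open>h\<^sub>i\<^sub>,\<^sub>r\<close> to \<open>h i r\<close>; here \<open>\<phi>\<close> should be a ring homomorphism and
  \<open>k' i\<close> the inverse of \<open>k i\<close>.
\<close>

definition U0_eval ::
    "(laurent \<Rightarrow> 'b::comm_ring_1) \<Rightarrow> ('i::finite \<Rightarrow> 'b) \<Rightarrow> ('i \<Rightarrow> 'b) \<Rightarrow> ('i \<Rightarrow> nzint \<Rightarrow> 'b) \<Rightarrow>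
     'i U0 \<Rightarrow> 'b" where
  "U0_eval \<phi> k k' h x =
     (\<Sum>m\<in>Poly_Mapping.keys x. \<phi> (Poly_Mapping.lookup x m) *
        (\<Prod>i\<in>UNIV. if Poly_Mapping.lookup (fst m) i \<ge> 0
           then k i ^ nat (Poly_Mapping.lookup (fst m) i)
           else k' i ^ nat (- Poly_Mapping.lookup (fst m) i)) *
        (\<Prod>g\<in>Poly_Mapping.keys (snd m). h (fst g) (snd g) ^ Poly_Mapping.lookup (snd m) g))"

text \<open>
  The monomials form a basis of \<open>'i U0\<close> over $\mathbb C[q,q^{-1}]$, so the tensor square over
  $\mathbb C[q,q^{-1}]$ is free on pairs of monomials, and as an algebra it is the monoid algebra
  of the product monoid.
\<close>

type_synonym 'i U0_tensor = "('i U0_mon \<times> 'i U0_mon) \<Rightarrow>\<^sub>0 laurent"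

definition U0_tensor_scalar :: "laurent \<Rightarrow> 'i U0_tensor" where
  "U0_tensor_scalar c = Poly_Mapping.single 0 c"

definition U0_otimes :: "'i U0 \<Rightarrow> 'i U0 \<Rightarrow> 'i U0_tensor" where
  "U0_otimes x y =
     (\<Sum>m\<in>Poly_Mapping.keys x. \<Sum>n\<in>Poly_Mapping.keys y.
        Poly_Mapping.single (m, n) (Poly_Mapping.lookup x m * Poly_Mapping.lookup y n))"

text \<open>The map \<open>T \<otimes> T\<close>, for \<open>T\<close> linear over $\mathbb C[q,q^{-1}]$.\<close>

definition U0_tensor_map :: "('i U0 \<Rightarrow> 'i U0) \<Rightarrow> 'i U0_tensor \<Rightarrow> 'i U0_tensor" where
  "U0_tensor_map T z =
     (\<Sum>mn\<in>Poly_Mapping.keys z. U0_tensor_scalar (Poly_Mapping.lookup z mn) *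
        U0_otimes (T (Poly_Mapping.single (fst mn) 1)) (T (Poly_Mapping.single (snd mn) 1)))"

definition U0_comult :: "'i::finite U0 \<Rightarrow> 'i U0_tensor" where
  "U0_comult = U0_eval U0_tensor_scalar
     (\<lambda>i. U0_otimes (U0_K i 1) (U0_K i 1))
     (\<lambda>i. U0_otimes (U0_K i (-1)) (U0_K i (-1)))
     (\<lambda>i r. U0_otimes (U0_h i r) 1 + U0_otimes 1 (U0_h i r))"

definition U0_counit :: "'i::finite U0 \<Rightarrow> laurent" where
  "U0_counit = U0_eval (\<lambda>c. c) (\<lambda>i. 1) (\<lambda>i. 1) (\<lambda>i r. 0)"

definition U0_antipode :: "'i::finite U0 \<Rightarrow> 'i U0" where
  "U0_antipode = U0_eval U0_scalar (\<lambda>i. U0_K i (-1)) (\<lambda>i. U0_K i 1) (\<lambda>i r. - U0_h i r)"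

definition U0_algebra_hom :: "('i U0 \<Rightarrow> 'i U0) \<Rightarrow> bool" where
  "U0_algebra_hom T \<longleftrightarrow>
     T 1 = 1 \<and>
     (\<forall>x y. T (x + y) = T x + T y) \<and>
     (\<forall>x y. T (x * y) = T x * T y) \<and>
     (\<forall>c x. T (U0_scalar c * x) = U0_scalar c * T x)"

definition U0_hopf_automorphism :: "('i::finite U0 \<Rightarrow> 'i U0) \<Rightarrow> bool" where
  "U0_hopf_automorphism T \<longleftrightarrow>
     bij T \<and> U0_algebra_hom T \<and>
     U0_comult \<circ> T = U0_tensor_map T \<circ> U0_comult \<and>
     U0_counit \<circ> T = U0_counit \<and>
     U0_antipode \<circ> T = T \<circ> U0_antipode"


section \<open>The commutative subalgebra $Y^0$ of the Yangian\<close>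

type_synonym 'i Y0 = "(('i \<times> nat) \<Rightarrow>\<^sub>0 nat) \<Rightarrow>\<^sub>0 complex"

definition Y0_scalar :: "complex \<Rightarrow> 'i Y0" where
  "Y0_scalar c = Poly_Mapping.single 0 c"

definition Y0_xi :: "'i \<Rightarrow> nat \<Rightarrow> 'i Y0" where
  "Y0_xi i r = Poly_Mapping.single (Poly_Mapping.single (i, r) 1) 1"

text \<open>The $\mathbb C$-algebra endomorphism with \<open>\<xi>\<^sub>i\<^sub>,\<^sub>r \<mapsto> g i r\<close>.\<close>

definition Y0_subst :: "('i \<Rightarrow> nat \<Rightarrow> 'i Y0) \<Rightarrow> 'i Y0 \<Rightarrow> 'i Y0" where
  "Y0_subst g p =
     (\<Sum>m\<in>Poly_Mapping.keys p. Y0_scalar (Poly_Mapping.lookup p m) *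
        (\<Prod>x\<in>Poly_Mapping.keys m. g (fst x) (snd x) ^ Poly_Mapping.lookup m x))"

definition Y0_degree :: "(('i \<times> nat) \<Rightarrow>\<^sub>0 nat) \<Rightarrow> nat" where
  "Y0_degree m = (\<Sum>x\<in>Poly_Mapping.keys m. snd x * Poly_Mapping.lookup m x)"

definition Y0_filtration :: "nat \<Rightarrow> 'i Y0 set" where
  "Y0_filtration n = {p. \<forall>m\<in>Poly_Mapping.keys p. Y0_degree m \<le> n}"

text \<open>
  Two kinds of power series over \<open>Y\<^sup>0\<close> occur, both represented by \<open>'i Y0 fps\<close>: series in
  $u^{-1}$, where the \<open>fps\<close> variable is $u^{-1}$, and series in the formal parameter \<open>v\<close>.
\<close>

definition Y0_emb :: "complex fps \<Rightarrow> 'i Y0 fps" where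
  "Y0_emb f = Abs_fps (\<lambda>n. Y0_scalar (fps_nth f n))"

definition xi_series :: "complex \<Rightarrow> 'i \<Rightarrow> 'i Y0 fps" where
  "xi_series hbar i = 1 + Abs_fps (\<lambda>n. if n = 0 then 0 else Y0_scalar hbar * Y0_xi i (n - 1))"

text \<open>
  \<open>fps_ln 1\<close> is the series $\log(1+X)$.
\<close>

definition log_xi_series :: "complex \<Rightarrow> 'i \<Rightarrow> 'i Y0 fps" where
  "log_xi_series hbar i = fps_compose (Y0_emb (fps_ln 1)) (xi_series hbar i - 1)"

definition Y0_t :: "complex \<Rightarrow> 'i \<Rightarrow> nat \<Rightarrow> 'i Y0" where
  "Y0_t hbar i r = Y0_scalar (1 / hbar) * fps_nth (log_xi_series hbar i) (r + 1)"

text \<open>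
  \<open>shift_series c F\<close> is $F(u - c)$ for a series \<open>F\<close> in $u^{-1}$, expanded again in $u^{-1}$: one
  substitutes $(u-c)^{-1} = \sum_{n\ge 1} c^{n-1}u^{-n}$ for $u^{-1}$.
\<close>

definition shift_series :: "complex \<Rightarrow> 'i Y0 fps \<Rightarrow> 'i Y0 fps" where
  "shift_series c F =
     fps_compose F (Y0_emb (Abs_fps (\<lambda>n. if n = 0 then 0 else c ^ (n - 1))))"

text \<open>
  The series $\xi_i(u)\prod_{k=0}^{|a_{ji}|-1}
  \xi_j\big(u-\frac{\hbar d_j}2(|a_{ji}|-2k)\big)^{(-1)^{\delta_{ij}}}$.  The factors have constant
  coefficient \<open>1\<close>, so \<open>fps_right_inverse _ 1\<close> is their inverse.
\<close>

definition braid_xi_series ::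
    "complex \<Rightarrow> ('i \<Rightarrow> 'i \<Rightarrow> int) \<Rightarrow> ('i \<Rightarrow> nat) \<Rightarrow> 'i \<Rightarrow> 'i \<Rightarrow> 'i Y0 fps" where
  "braid_xi_series hbar a d j i = xi_series hbar i *
     (\<Prod>k<nat \<bar>a j i\<bar>.
        let F = shift_series (hbar * of_nat (d j) / 2 * (of_int \<bar>a j i\<bar> - 2 * of_nat k)) (xi_series hbar j)
        in if i = j then fps_right_inverse F 1 else F)"

text \<open>
  The modified braid group operator on \<open>Y\<^sup>0\<close>: the algebra map sending the coefficients of
  \<open>\<xi>\<^sub>i(u)\<close> to those of \<open>braid_xi_series hbar a d j i\<close>; see \<open>Y0_braid_xi_series\<close> below.
\<close>

definition Y0_braid ::
    "complex \<Rightarrow> ('i \<Rightarrow> 'i \<Rightarrow> int) \<Rightarrow> ('i \<Rightarrow> nat) \<Rightarrow> 'i \<Rightarrow> 'i Y0 \<Rightarrow> 'i Y0" where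
  "Y0_braid hbar a d j =
     Y0_subst (\<lambda>i r. Y0_scalar (1 / hbar) * fps_nth (braid_xi_series hbar a d j i) (r + 1))"


section \<open>The completion and the embedding $\Phi$\<close>

text \<open>Series in \<open>v\<close> whose coefficient at $v^n$ has filtration degree at most \<open>n\<close>.\<close>

definition Y0_completion :: "'i Y0 fps set" where
  "Y0_completion = {f. \<forall>n. fps_nth f n \<in> Y0_filtration n}"

definition Y0_braid_hat ::
    "complex \<Rightarrow> ('i \<Rightarrow> 'i \<Rightarrow> int) \<Rightarrow> ('i \<Rightarrow> nat) \<Rightarrow> 'i \<Rightarrow> 'i Y0 fps \<Rightarrow> 'i Y0 fps" where
  "Y0_braid_hat hbar a d j f = Abs_fps (\<lambda>n. Y0_braid hbar a d j (fps_nth f n))"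

text \<open>The structure map $q\mapsto e^{v/2}$.\<close>

definition laurent_to_series :: "laurent \<Rightarrow> 'i Y0 fps" where
  "laurent_to_series c =
     Y0_emb (\<Sum>n\<in>Poly_Mapping.keys c. fps_const (Poly_Mapping.lookup c n) * fps_exp (of_int n / 2))"

text \<open>\<open>Y0_exp_v y\<close> is \<open>exp(v y)\<close>.\<close>

definition Y0_exp_v :: "'i Y0 \<Rightarrow> 'i Y0 fps" where
  "Y0_exp_v y = Abs_fps (\<lambda>n. Y0_scalar (1 / fact n) * y ^ n)"

text \<open>\<open>borel_series hbar i c\<close> is $\mathcal B_i(cv)$, as a series in \<open>v\<close>.\<close>

definition borel_series :: "complex \<Rightarrow> 'i \<Rightarrow> complex \<Rightarrow> 'i Y0 fps" where
  "borel_series hbar i c = Abs_fps (\<lambda>n. Y0_scalar (hbar * c ^ n / fact n) * Y0_t hbar i n)"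

definition Phi :: "complex \<Rightarrow> ('i::finite \<Rightarrow> nat) \<Rightarrow> 'i U0 \<Rightarrow> 'i Y0 fps" where
  "Phi hbar d = U0_eval laurent_to_series
     (\<lambda>i. Y0_exp_v (Y0_scalar (1 / 2) * Y0_xi i 0))
     (\<lambda>i. Y0_exp_v (Y0_scalar (- 1 / 2) * Y0_xi i 0))
     (\<lambda>i r. let s = of_int (int (d i) * int_of_nzint r) / 2 in
        Y0_emb (fps_X / (fps_exp s - fps_exp (- s))) *
        borel_series hbar i (of_int (int_of_nzint r) / hbar))"


section \<open>Well-definedness of $\mathsf T_j$ and $\Phi$ as maps of filtered objects\<close>

lemma Y0_subst_scalar_mult_xi: "Y0_subst g (Y0_scalar c * Y0_xi i r) = Y0_scalar c * g i r"
  by (cases "c = 0") (simp_all add: Y0_subst_def Y0_scalar_def Y0_xi_def mult_single)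

lemma Y0_subst_one: "Y0_subst g 1 = 1"
  by (simp add: Y0_subst_def Y0_scalar_def)

lemma braid_xi_series_nth_0: "fps_nth (braid_xi_series hbar a d j i) 0 = 1"
proof -
  have xi: "fps_nth (xi_series hbar k) 0 = 1" for k :: 'a
    by (simp add: xi_series_def)
  have shift: "fps_nth (shift_series c (xi_series hbar k)) 0 = 1" for c and k :: 'a
    by (simp add: shift_series_def xi)
  have prod: "fps_nth (prod F A) 0 = 1"
    if "\<And>k. fps_nth (F k) 0 = (1 :: 'a Y0)" for F and A :: "nat set"
    using that by (induction A rule: infinite_finite_induct) auto
  show ?thesis
    by (simp add: braid_xi_series_def xi Let_def prod shift)
qed

lemma Y0_braid_xi_series:
  assumes "hbar \<noteq> 0"
  shows "Abs_fps (\<lambda>n. Y0_braid hbar a d j (fps_nth (xi_series hbar i) n)) = braid_xi_series hbar a d j i"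
proof (rule fps_ext)
  fix n
  show "fps_nth (Abs_fps (\<lambda>n. Y0_braid hbar a d j (fps_nth (xi_series hbar i) n))) n
      = fps_nth (braid_xi_series hbar a d j i) n"
  proof (cases n)
    case 0
    then show ?thesis
      by (simp add: xi_series_def Y0_braid_def Y0_subst_one braid_xi_series_nth_0)
  next
    case (Suc r)
    have "Y0_scalar hbar * (Y0_scalar (1 / hbar) * p) = p" for p :: "'a Y0"
      using assms by (simp add: Y0_scalar_def mult_single flip: mult.assoc)
    then show ?thesis
      by (simp add: Suc xi_series_def Y0_braid_def Y0_subst_scalar_mult_xi)
  qed
qed

lemma Y0_degree_superset:
  assumes "finite A" "Poly_Mapping.keys m \<subseteq> A"
  shows "Y0_degree m = (\<Sum>x\<in>A. snd x * Poly_Mapping.lookup m x)"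
  unfolding Y0_degree_def
  by (rule sum.mono_neutral_left) (use assms in \<open>auto simp: in_keys_iff\<close>)

lemma Y0_degree_add: "Y0_degree (m + n) = Y0_degree m + Y0_degree n"
proof -
  let ?A = "Poly_Mapping.keys m \<union> Poly_Mapping.keys n"
  have "Poly_Mapping.keys (m + n) \<subseteq> ?A"
    by (rule Poly_Mapping.keys_add)
  then show ?thesis
    using Y0_degree_superset[of ?A m] Y0_degree_superset[of ?A n] Y0_degree_superset[of ?A "m + n"]
    by (simp add: lookup_add algebra_simps sum.distrib)
qed

lemma Y0_filtration_mono: "p \<in> Y0_filtration k \<Longrightarrow> k \<le> n \<Longrightarrow> p \<in> Y0_filtration n"
  by (force simp: Y0_filtration_def)

lemma Y0_filtration_scalar: "Y0_scalar c \<in> Y0_filtration n"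
  by (auto simp: Y0_filtration_def Y0_scalar_def Y0_degree_def split: if_splits)

lemma Y0_filtration_one: "1 \<in> Y0_filtration n"
  using Y0_filtration_scalar[of 1 n] by (simp add: Y0_scalar_def)

lemma Y0_filtration_zero: "0 \<in> Y0_filtration n"
  by (simp add: Y0_filtration_def)

lemma Y0_filtration_xi: "Y0_xi i r \<in> Y0_filtration r"
  by (simp add: Y0_filtration_def Y0_xi_def Y0_degree_def)

lemma Y0_filtration_add: "p \<in> Y0_filtration n \<Longrightarrow> q \<in> Y0_filtration n \<Longrightarrow> p + q \<in> Y0_filtration n"
  unfolding Y0_filtration_def using Poly_Mapping.keys_add[of p q] by auto

lemma Y0_filtration_uminus: "p \<in> Y0_filtration n \<Longrightarrow> - p \<in> Y0_filtration n"
  by (simp add: Y0_filtration_def)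

lemma Y0_filtration_mult:
  assumes "p \<in> Y0_filtration k" "q \<in> Y0_filtration l" "k + l \<le> n"
  shows "p * q \<in> Y0_filtration n"
  unfolding Y0_filtration_def
proof (rule CollectI, rule ballI)
  fix m assume "m \<in> Poly_Mapping.keys (p * q)"
  then obtain x y where "m = x + y" "x \<in> Poly_Mapping.keys p" "y \<in> Poly_Mapping.keys q"
    using Poly_Mapping.keys_mult[of p q] by blast
  then show "Y0_degree m \<le> n"
    using assms by (force simp: Y0_degree_add Y0_filtration_def)
qed

lemma Y0_filtration_sum: "(\<And>x. x \<in> A \<Longrightarrow> f x \<in> Y0_filtration n) \<Longrightarrow> sum f A \<in> Y0_filtration n"
  by (induction A rule: infinite_finite_induct) (auto simp: Y0_filtration_zero Y0_filtration_add)

lemma Y0_filtration_power: "p \<in> Y0_filtration k \<Longrightarrow> p ^ l \<in> Y0_filtration (k * l)"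
  by (induction l) (auto simp: Y0_filtration_one intro: Y0_filtration_mult)

lemma Y0_filtration_prod:
  "(\<And>x. x \<in> A \<Longrightarrow> f x \<in> Y0_filtration (k x)) \<Longrightarrow> prod f A \<in> Y0_filtration (sum k A)"
  by (induction A rule: infinite_finite_induct) (auto simp: Y0_filtration_one intro: Y0_filtration_mult)

lemma Y0_filtration_subst:
  assumes g: "\<And>i r. g i r \<in> Y0_filtration r" and p: "p \<in> Y0_filtration n"
  shows "Y0_subst g p \<in> Y0_filtration n"
  unfolding Y0_subst_def
proof (rule Y0_filtration_sum)
  fix m assume m: "m \<in> Poly_Mapping.keys p"
  have "(\<Prod>x\<in>Poly_Mapping.keys m. g (fst x) (snd x) ^ Poly_Mapping.lookup m x)
      \<in> Y0_filtration (Y0_degree m)"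
    unfolding Y0_degree_def by (intro Y0_filtration_prod Y0_filtration_power g)
  with m p show "Y0_scalar (Poly_Mapping.lookup p m) *
      (\<Prod>x\<in>Poly_Mapping.keys m. g (fst x) (snd x) ^ Poly_Mapping.lookup m x) \<in> Y0_filtration n"
    by (intro Y0_filtration_mult[OF Y0_filtration_scalar[of _ 0]]) (auto simp: Y0_filtration_def)
qed

text \<open>Series in $u^{-1}$ like \<open>\<xi>\<^sub>i(u)\<close>, with coefficient at $u^{-r-1}$ of degree at most \<open>r\<close>.\<close>

definition Y0_delayed :: "'i Y0 fps set" where
  "Y0_delayed = {f. \<forall>n. fps_nth f n \<in> Y0_filtration (n - 1)}"

lemma Y0_delayed_one: "1 \<in> Y0_delayed"
  by (simp add: Y0_delayed_def Y0_filtration_one Y0_filtration_zero)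

lemma Y0_delayed_mult: "f \<in> Y0_delayed \<Longrightarrow> g \<in> Y0_delayed \<Longrightarrow> f * g \<in> Y0_delayed"
  by (auto simp: Y0_delayed_def fps_mult_nth intro!: Y0_filtration_sum intro: Y0_filtration_mult)

lemma Y0_delayed_power: "f \<in> Y0_delayed \<Longrightarrow> f ^ n \<in> Y0_delayed"
  by (induction n) (auto simp: Y0_delayed_one Y0_delayed_mult)

lemma Y0_delayed_prod: "(\<And>x. x \<in> A \<Longrightarrow> f x \<in> Y0_delayed) \<Longrightarrow> prod f A \<in> Y0_delayed"
  by (induction A rule: infinite_finite_induct) (auto simp: Y0_delayed_one Y0_delayed_mult)

lemma Y0_delayed_right_inverse:
  assumes "f \<in> Y0_delayed"
  shows "fps_right_inverse f 1 \<in> Y0_delayed"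
proof -
  have "fps_nth (fps_right_inverse f 1) n \<in> Y0_filtration (n - 1)" for n
  proof (induction n rule: less_induct)
    case (less n)
    show ?case
    proof (cases n)
      case 0
      then show ?thesis by (simp add: Y0_filtration_one)
    next
      case (Suc m)
      have "fps_nth f k * fps_nth (fps_right_inverse f 1) (n - k) \<in> Y0_filtration (n - 1)"
        if "k \<in> {1..n}" for k
        using that assms less.IH[of "n - k"]
        by (intro Y0_filtration_mult[of _ "k - 1" _ "n - k - 1"]) (auto simp: Y0_delayed_def)
      then have "(\<Sum>k=1..n. fps_nth f k * fps_nth (fps_right_inverse f 1) (n - k))
          \<in> Y0_filtration (n - 1)"
        by (rule Y0_filtration_sum)
      then have "- (\<Sum>k=1..n. fps_nth f k * fps_nth (fps_right_inverse f 1) (n - k))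
          \<in> Y0_filtration (n - 1)"
        by (rule Y0_filtration_uminus)
      then show ?thesis
        by (simp add: Suc)
    qed
  qed
  then show ?thesis by (simp add: Y0_delayed_def)
qed

lemma Y0_delayed_xi_series: "xi_series hbar i \<in> Y0_delayed"
  by (auto simp: Y0_delayed_def xi_series_def Y0_filtration_one
      intro: Y0_filtration_mult[OF Y0_filtration_scalar[of _ 0] Y0_filtration_xi])

lemma Y0_scalar_series_power:
  assumes "\<And>n. fps_nth f n \<in> Y0_filtration 0"
  shows "fps_nth (f ^ l) n \<in> Y0_filtration 0"
proof (induction l arbitrary: n)
  case 0
  show ?case by (simp add: Y0_filtration_one Y0_filtration_zero)
next
  case (Suc l)
  then show ?case
    by (auto simp: fps_mult_nth intro!: Y0_filtration_sum intro: Y0_filtration_mult assms)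
qed

lemma Y0_delayed_shift_series:
  fixes f :: "'i Y0 fps"
  assumes "f \<in> Y0_delayed"
  shows "shift_series c f \<in> Y0_delayed"
  unfolding Y0_delayed_def mem_Collect_eq shift_series_def fps_compose_nth
proof (intro allI Y0_filtration_sum)
  fix n k :: nat assume k: "k \<in> {0..n}"
  let ?G = "Y0_emb (Abs_fps (\<lambda>n. if n = 0 then 0 else c ^ (n - 1))) :: 'i Y0 fps"
  have "fps_nth (?G ^ k) n \<in> Y0_filtration 0"
    by (rule Y0_scalar_series_power) (simp add: Y0_emb_def Y0_filtration_scalar)
  then show "fps_nth f k * fps_nth (?G ^ k) n \<in> Y0_filtration (n - 1)"
    using assms k by (intro Y0_filtration_mult[of _ "k - 1" _ 0]) (auto simp: Y0_delayed_def)
qed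

lemma Y0_delayed_braid_xi_series: "braid_xi_series hbar a d j i \<in> Y0_delayed"
  unfolding braid_xi_series_def Let_def
  by (auto intro!: Y0_delayed_mult Y0_delayed_prod Y0_delayed_right_inverse
      Y0_delayed_shift_series Y0_delayed_xi_series)

lemma Y0_filtration_braid:
  assumes "p \<in> Y0_filtration n"
  shows "Y0_braid hbar a d j p \<in> Y0_filtration n"
  unfolding Y0_braid_def
proof (rule Y0_filtration_subst[OF _ assms])
  fix i r
  show "Y0_scalar (1 / hbar) * fps_nth (braid_xi_series hbar a d j i) (r + 1) \<in> Y0_filtration r"
    using Y0_delayed_braid_xi_series[of hbar a d j i]
    by (intro Y0_filtration_mult[OF Y0_filtration_scalar[of _ 0], of _ r])
       (auto simp: Y0_delayed_def dest: spec[of _ "r + 1"])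
qed

theorem Y0_completion_braid_hat:
  "f \<in> Y0_completion \<Longrightarrow> Y0_braid_hat hbar a d j f \<in> Y0_completion"
  by (simp add: Y0_completion_def Y0_braid_hat_def Y0_filtration_braid)

lemma Y0_filtration_t: "Y0_t hbar i r \<in> Y0_filtration r"
proof -
  have "xi_series hbar i - 1 \<in> Y0_delayed"
    by (auto simp: Y0_delayed_def xi_series_def Y0_filtration_zero
        intro: Y0_filtration_mult[OF Y0_filtration_scalar[of _ 0] Y0_filtration_xi])
  then have pow: "fps_nth ((xi_series hbar i - 1) ^ l) n \<in> Y0_filtration (n - 1)" for l n
    using Y0_delayed_power[of "xi_series hbar i - 1" l] by (simp add: Y0_delayed_def)
  have "fps_nth (log_xi_series hbar i) (r + 1) \<in> Y0_filtration r"
    unfolding log_xi_series_def fps_compose_nth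
  proof (rule Y0_filtration_sum)
    fix l
    show "fps_nth (Y0_emb (fps_ln 1)) l * fps_nth ((xi_series hbar i - 1) ^ l) (r + 1)
        \<in> Y0_filtration r"
      using pow[of l "r + 1"]
      by (intro Y0_filtration_mult[of _ 0 _ r]) (simp_all add: Y0_emb_def Y0_filtration_scalar)
  qed
  then show ?thesis
    unfolding Y0_t_def by (rule Y0_filtration_mult[OF Y0_filtration_scalar[of _ 0]]) simp
qed

lemma Y0_completion_mult: "f \<in> Y0_completion \<Longrightarrow> g \<in> Y0_completion \<Longrightarrow> f * g \<in> Y0_completion"
  by (auto simp: Y0_completion_def fps_mult_nth intro!: Y0_filtration_sum intro: Y0_filtration_mult)

lemma Y0_completion_one: "1 \<in> Y0_completion"
  by (simp add: Y0_completion_def Y0_filtration_one Y0_filtration_zero)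

lemma Y0_completion_power: "f \<in> Y0_completion \<Longrightarrow> f ^ n \<in> Y0_completion"
  by (induction n) (auto simp: Y0_completion_one Y0_completion_mult)

lemma Y0_completion_prod: "(\<And>x. x \<in> A \<Longrightarrow> f x \<in> Y0_completion) \<Longrightarrow> prod f A \<in> Y0_completion"
  by (induction A rule: infinite_finite_induct) (auto simp: Y0_completion_one Y0_completion_mult)

lemma Y0_completion_sum: "(\<And>x. x \<in> A \<Longrightarrow> f x \<in> Y0_completion) \<Longrightarrow> sum f A \<in> Y0_completion"
  by (auto simp: Y0_completion_def fps_sum_nth intro!: Y0_filtration_sum)

lemma Y0_completion_emb: "Y0_emb f \<in> Y0_completion"
  by (simp add: Y0_completion_def Y0_emb_def Y0_filtration_scalar)

lemma Y0_completion_exp_v: "Y0_exp_v (Y0_scalar c * Y0_xi i 0) \<in> Y0_completion"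
proof -
  have "Y0_scalar c * Y0_xi i 0 \<in> Y0_filtration 0"
    by (rule Y0_filtration_mult[OF Y0_filtration_scalar Y0_filtration_xi]) simp
  then have "(Y0_scalar c * Y0_xi i 0) ^ n \<in> Y0_filtration 0" for n
    using Y0_filtration_power[of _ 0 n] by simp
  then show ?thesis
    by (auto simp: Y0_completion_def Y0_exp_v_def
        intro!: Y0_filtration_mult[OF Y0_filtration_scalar[of _ 0]] intro: Y0_filtration_mono)
qed

lemma Y0_completion_borel_series: "borel_series hbar i c \<in> Y0_completion"
  by (auto simp: Y0_completion_def borel_series_def
      intro!: Y0_filtration_mult[OF Y0_filtration_scalar[of _ 0] Y0_filtration_t])

theorem Phi_in_completion: "Phi hbar d x \<in> Y0_completion"
  unfolding Phi_def U0_eval_def Let_def laurent_to_series_def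
  by (auto intro!: Y0_completion_sum Y0_completion_mult Y0_completion_prod Y0_completion_power
      Y0_completion_emb Y0_completion_exp_v Y0_completion_borel_series)

end

theory Submission
  imports Defs "HOL-Analysis.FPS_Convergence"
begin

text \<open>
  The homomorphism \<open>T\<close> is written down on generators by the asserted formulas
  (\<open>U0_reflection\<close> with the coefficients \<open>braid_coeff\<close>), and three facts give the theorem:
  \<open>T\<close> is a Hopf automorphism, it intertwines the braid operator through \<open>\<Phi>\<close>, and \<open>\<Phi>\<close> is
  injective. Injectivity makes every other solution equal to \<open>T\<close>, so that the formulas hold for
  the unique solution.

  Intertwining (\<open>Phi_reflection\<close>). Both composites are ring homomorphisms, so only the generators
  matter. On logarithms the braid operator is additive: $\log\xi_i(u)$ goes to $\log\xi_i(u)$ plus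
  or minus a sum of translates of $\log\xi_j(u)$. The Borel transform turns translation by $s$ into
  multiplication by $e^{sz}$ (\<open>borel_transform_translation\<close>), so the sum over the translates
  becomes a geometric sum of exponentials (\<open>fps_exp_geometric_sum\<close>). Its value is, up to
  sign, the multiple $q_j^r[a_{ji}]$ of a quantum integer at $q_j^r$, which accounts for the
  coefficient in the formula for \<open>h\<^sub>i\<^sub>,\<^sub>r\<close>.

  Power series calculus is easiest over a field, so such identities over \<open>Y\<^sup>0\<close> are tested on
  characters, the algebra homomorphisms from \<open>Y\<^sup>0\<close> to $\mathbb C$ applied to every coefficient. They
  separate the elements of \<open>Y\<^sup>0\<close> because distinct monomials are distinct characters of the
  multiplicative monoid of points, hence linearly independent by Dedekind's theorem
  (\<open>independence_of_characters\<close>).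

  Injectivity (\<open>Phi_eq_0_iff\<close>). A character of \<open>Y\<^sup>0\<close> may prescribe the series $\log\xi_i(u)$
  freely, so the Borel transforms can be taken to be polynomials $p_i$. Then the image of \<open>x\<close>
  under \<open>\<Phi>\<close> and the character converges at small complex \<open>v = z\<close>. There $K_i$ takes the value
  $\exp(z p_i(0)/2\hbar)$, and $h_{i,r}$ is a nonzero multiple of $p_i(rz/\hbar)$.
  The points $0$ and $rz/\hbar$ are distinct, so by interpolation the finitely many $K_i$ and $h_{i,r}$
  occurring in \<open>x\<close> can be given arbitrary values (nonzero for the $K_i$), with \<open>q = exp (z/2)\<close>. If
  \<open>x\<close> is nonzero, some coefficient is nonzero at such a \<open>q\<close>, and by independence of characters
  some choice of values makes the whole of \<open>x\<close> nonzero.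

  Hopf automorphism (\<open>reflection_hopf\<close>, \<open>bij_braid_reflection\<close>). Each \<open>K\<^sub>i\<close> goes to a product of
  grouplike elements, and each \<open>h\<^sub>i\<^sub>,\<^sub>r\<close> to a combination of primitive elements over the base
  ring, so the Hopf structure is preserved. The inverse has the same
  shape, because $h_{j,r}$ is sent to its multiple by the unit $-q_j^{2r}$.
\<close>

section \<open>Ring homomorphisms\<close>

locale ring_morphism =
  fixes f :: "'a::comm_ring_1 \<Rightarrow> 'b::comm_ring_1"
  assumes one: "f 1 = 1"
    and add: "f (x + y) = f x + f y"
    and mult: "f (x * y) = f x * f y"
begin

lemma zero: "f 0 = 0"
  using add[of 0 0] by simp

lemma uminus: "f (- x) = - f x"
  using add[of x "- x"] by (simp add: zero eq_neg_iff_add_eq_0 add.commute)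

lemma diff: "f (x - y) = f x - f y"
  using add[of x "- y"] by (simp add: uminus)

lemma sum: "f (sum g A) = (\<Sum>x\<in>A. f (g x))"
  by (induction A rule: infinite_finite_induct) (simp_all add: zero add)

lemma prod: "f (prod g A) = (\<Prod>x\<in>A. f (g x))"
  by (induction A rule: infinite_finite_induct) (simp_all add: one mult)

lemma power: "f (x ^ n) = f x ^ n"
  by (induction n) (simp_all add: one mult)

end

lemma ring_morphism_comp: "ring_morphism f \<Longrightarrow> ring_morphism g \<Longrightarrow> ring_morphism (\<lambda>x. g (f x))"
  by (simp add: ring_morphism_def)

lemma ring_morphism_id: "ring_morphism (\<lambda>x. x)"
  by (simp add: ring_morphism_def)

section \<open>Monoid algebras\<close>

lemma sum_singles: "(\<Sum>m\<in>Poly_Mapping.keys x. Poly_Mapping.single m (Poly_Mapping.lookup x m)) = x"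
  by (rule poly_mapping_eqI) (simp add: lookup_sum lookup_single when_def in_keys_iff)

text \<open>
  Every element is the finite sum of its terms. Multiplicativity and the compatibilities with
  tensor products are reduced to monomials in this way.
\<close>

lemma additive_ext:
  fixes f g :: "('m \<Rightarrow>\<^sub>0 'c::comm_monoid_add) \<Rightarrow> 'b::ab_group_add"
  assumes f: "\<And>x y. f (x + y) = f x + f y" and g: "\<And>x y. g (x + y) = g x + g y"
    and single: "\<And>m c. f (Poly_Mapping.single m c) = g (Poly_Mapping.single m c)"
  shows "f x = g x"
proof -
  have 0: "f 0 = 0" "g 0 = 0"
    using f[of 0 0] g[of 0 0] by simp_all
  have "f (sum h A) = g (sum h A)" if "\<And>a. a \<in> A \<Longrightarrow> f (h a) = g (h a)" for h and A :: "'m set"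
    using that by (induction A rule: infinite_finite_induct) (simp_all add: 0 f g)
  from this[of "Poly_Mapping.keys x" "\<lambda>m. Poly_Mapping.single m (Poly_Mapping.lookup x m)"] single
  show ?thesis
    by (simp add: sum_singles)
qed

definition monoid_eval ::
    "('c::zero \<Rightarrow> 'b::comm_ring_1) \<Rightarrow> ('m \<Rightarrow> 'b) \<Rightarrow> ('m \<Rightarrow>\<^sub>0 'c) \<Rightarrow> 'b" where
  "monoid_eval \<phi> \<mu> x = (\<Sum>m\<in>Poly_Mapping.keys x. \<phi> (Poly_Mapping.lookup x m) * \<mu> m)"

lemma monoid_eval_superset:
  assumes "\<phi> 0 = 0" "finite A" "Poly_Mapping.keys x \<subseteq> A"
  shows "monoid_eval \<phi> \<mu> x = (\<Sum>m\<in>A. \<phi> (Poly_Mapping.lookup x m) * \<mu> m)"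
  unfolding monoid_eval_def
  by (rule sum.mono_neutral_left) (use assms in \<open>auto simp: in_keys_iff\<close>)

lemma monoid_eval_single:
  assumes "\<phi> 0 = 0"
  shows "monoid_eval \<phi> \<mu> (Poly_Mapping.single m c) = \<phi> c * \<mu> m"
  using monoid_eval_superset[of \<phi> "{m}" "Poly_Mapping.single m c" \<mu>] assms by simp

lemma monoid_eval_add:
  assumes "ring_morphism \<phi>"
  shows "monoid_eval \<phi> \<mu> (x + y) = monoid_eval \<phi> \<mu> x + monoid_eval \<phi> \<mu> y"
proof -
  interpret ring_morphism \<phi> by fact
  let ?A = "Poly_Mapping.keys x \<union> Poly_Mapping.keys y"
  have "Poly_Mapping.keys (x + y) \<subseteq> ?A"
    by (rule Poly_Mapping.keys_add)
  then show ?thesis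
    by (simp add: monoid_eval_superset[of \<phi> ?A] zero lookup_add add distrib_right sum.distrib)
qed

lemma ring_morphism_monoid_eval:
  fixes \<mu> :: "'m::comm_monoid_add \<Rightarrow> 'b::comm_ring_1"
  assumes \<phi>: "ring_morphism \<phi>"
    and \<mu>: "\<mu> 0 = 1" "\<And>m n. \<mu> (m + n) = \<mu> m * \<mu> n"
  shows "ring_morphism (monoid_eval \<phi> \<mu>)"
proof -
  interpret ring_morphism \<phi> by fact
  note add' = monoid_eval_add[OF \<phi>, of \<mu>]
  have single: "monoid_eval \<phi> \<mu> (Poly_Mapping.single m c) = \<phi> c * \<mu> m" for m c
    by (rule monoid_eval_single) (rule zero)
  show ?thesis
  proof
    show "monoid_eval \<phi> \<mu> 1 = 1"
      using single[of 0 1] by (simp add: one \<mu>)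
    show "monoid_eval \<phi> \<mu> (x * y) = monoid_eval \<phi> \<mu> x * monoid_eval \<phi> \<mu> y" for x y
    proof (rule additive_ext[where x = x])
      show "monoid_eval \<phi> \<mu> (Poly_Mapping.single m c * y)
          = monoid_eval \<phi> \<mu> (Poly_Mapping.single m c) * monoid_eval \<phi> \<mu> y" for m c
        by (rule additive_ext[where x = y])
           (simp add: distrib_left add', simp add: distrib_left add',
            simp add: mult_single single mult \<mu> mult_ac)
    qed (simp_all add: add' distrib_right)
  qed (rule add')
qed

definition exponent_eval :: "('g \<Rightarrow> 'b::comm_ring_1) \<Rightarrow> ('g \<Rightarrow>\<^sub>0 nat) \<Rightarrow> 'b" where
  "exponent_eval h m = (\<Prod>g\<in>Poly_Mapping.keys m. h g ^ Poly_Mapping.lookup m g)"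

lemma exponent_eval_superset:
  assumes "finite A" "Poly_Mapping.keys m \<subseteq> A"
  shows "exponent_eval h m = (\<Prod>g\<in>A. h g ^ Poly_Mapping.lookup m g)"
  unfolding exponent_eval_def
  by (rule prod.mono_neutral_left) (use assms in \<open>auto simp: in_keys_iff\<close>)

lemma exponent_eval_0: "exponent_eval h 0 = 1"
  by (simp add: exponent_eval_def)

lemma exponent_eval_single: "exponent_eval h (Poly_Mapping.single g n) = h g ^ n"
  using exponent_eval_superset[of "{g}" "Poly_Mapping.single g n" h] by simp

lemma exponent_eval_add: "exponent_eval h (m + n) = exponent_eval h m * exponent_eval h n"
proof -
  let ?A = "Poly_Mapping.keys m \<union> Poly_Mapping.keys n"
  have "Poly_Mapping.keys (m + n) \<subseteq> ?A"
    by (rule Poly_Mapping.keys_add)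
  then show ?thesis
    by (simp add: exponent_eval_superset[of ?A] lookup_add power_add prod.distrib)
qed

lemma exponent_eval_mult: "exponent_eval (\<lambda>g. h g * h' g) m = exponent_eval h m * exponent_eval h' m"
  by (simp add: exponent_eval_def power_mult_distrib prod.distrib)

text \<open>
  The second argument stands for the inverse of the first, so that integer powers of units make
  sense in any commutative ring, as in \<open>U0_eval\<close>.
\<close>

definition signed_power :: "'b::comm_ring_1 \<Rightarrow> 'b \<Rightarrow> int \<Rightarrow> 'b" where
  "signed_power k k' n = (if n \<ge> 0 then k ^ nat n else k' ^ nat (- n))"

lemma signed_power_0 [simp]: "signed_power k k' 0 = 1"
  by (simp add: signed_power_def)

text \<open>
  Crossing from negative to nonnegative exponents is where \<open>k * k' = 1\<close> enters.
\<close>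

lemma signed_power_add_one:
  assumes "k * k' = 1"
  shows "signed_power k k' (n + 1) = signed_power k k' n * k"
proof -
  consider "n \<ge> 0" | "n < 0" by linarith
  then show ?thesis
  proof cases
    case 1
    then show ?thesis by (simp add: signed_power_def nat_add_distrib mult.commute)
  next
    case 2
    then have "nat (- n) = Suc (nat (- (n + 1)))" by simp
    then have "k' ^ nat (- n) * k = k' ^ nat (- (n + 1)) * (k * k')"
      by (simp add: mult_ac)
    then have "k' ^ nat (- n) * k = k' ^ nat (- (n + 1))"
      by (simp add: assms)
    then show ?thesis
      using 2 by (auto simp: signed_power_def)
  qed
qed

lemma signed_power_add:
  assumes "k * k' = 1"
  shows "signed_power k k' (m + n) = signed_power k k' m * signed_power k k' n"
proof (induction n rule: int_induct[where k = 0])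
  case (step1 n)
  then show ?case
    using signed_power_add_one[OF assms, of "m + n"] signed_power_add_one[OF assms, of n]
    by (simp add: add.assoc mult.assoc)
next
  case (step2 n)
  have *: "x = y" if "x * k = y * k" for x y
    using that assms by (metis mult.assoc mult.right_neutral)
  have "signed_power k k' (m + (n - 1)) * k = signed_power k k' m * signed_power k k' (n - 1) * k"
    using step2 signed_power_add_one[OF assms, of "m + (n - 1)"]
      signed_power_add_one[OF assms, of "n - 1"]
    by (simp add: mult.assoc)
  then show ?case by (rule *)
qed simp

lemma signed_power_mult:
  "signed_power (k * l) (k' * l') n = signed_power k k' n * signed_power l l' n"
  by (simp add: signed_power_def power_mult_distrib)

section \<open>Independence of characters\<close>

text \<open>
  Dedekind's argument: if a relation involves two different characters, multiplying the relation
  by the value of one of them at a point where they differ, and comparing with the relation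
  translated by that point, gives a shorter relation.
\<close>

lemma independence_of_characters:
  fixes \<psi> :: "'s \<Rightarrow> 'p \<Rightarrow> 'a::idom"
  assumes "finite S"
    and P: "e \<in> P" "\<And>p q. p \<in> P \<Longrightarrow> q \<in> P \<Longrightarrow> opn p q \<in> P"
    and \<psi>: "\<And>s. s \<in> S \<Longrightarrow> \<psi> s e = 1"
      "\<And>s p q. s \<in> S \<Longrightarrow> p \<in> P \<Longrightarrow> q \<in> P \<Longrightarrow> \<psi> s (opn p q) = \<psi> s p * \<psi> s q"
    and distinct: "\<And>s t. s \<in> S \<Longrightarrow> t \<in> S \<Longrightarrow> s \<noteq> t \<Longrightarrow> \<exists>p\<in>P. \<psi> s p \<noteq> \<psi> t p"
    and vanish: "\<And>p. p \<in> P \<Longrightarrow> (\<Sum>s\<in>S. c s * \<psi> s p) = 0"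
    and "s \<in> S"
  shows "c s = 0"
proof -
  have "\<forall>c. (\<forall>p\<in>P. (\<Sum>s\<in>S. c s * \<psi> s p) = 0) \<longrightarrow> (\<forall>s\<in>S. c s = 0)"
    using \<open>finite S\<close> \<psi> distinct
  proof (induction S rule: finite_induct)
    case (insert t S)
    have IH: "(\<And>p. p \<in> P \<Longrightarrow> (\<Sum>s\<in>S. c s * \<psi> s p) = 0) \<Longrightarrow> s \<in> S \<Longrightarrow> c s = 0" for c s
      using insert.IH insert.prems by blast
    show ?case
    proof (intro allI impI)
      fix c assume c: "\<forall>p\<in>P. (\<Sum>s\<in>insert t S. c s * \<psi> s p) = 0"
      have zero: "c s = 0" if s: "s \<in> S" for s
      proof -
        from s insert.hyps insert.prems(3)[of s t] obtain q where q: "q \<in> P" "\<psi> s q \<noteq> \<psi> t q"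
          by auto
        \<comment> \<open>Subtracting \<open>\<psi> t q\<close> times the relation at \<open>p\<close> from the relation at the product
          of \<open>p\<close> and \<open>q\<close> removes the term of \<open>t\<close>.\<close>
        have "(\<Sum>u\<in>S. c u * (\<psi> u q - \<psi> t q) * \<psi> u p) = 0" if p: "p \<in> P" for p
        proof -
          have "c t * \<psi> t p + (\<Sum>u\<in>S. c u * \<psi> u p) = 0"
            using c p insert.hyps by simp
          moreover have "c t * \<psi> t (opn p q) + (\<Sum>u\<in>S. c u * \<psi> u (opn p q)) = 0"
            using c P(2)[OF p q(1)] insert.hyps by simp
          then have "c t * \<psi> t p * \<psi> t q + (\<Sum>u\<in>S. c u * \<psi> u p * \<psi> u q) = 0"
            using p q insert.prems(2) by (simp add: mult.assoc cong: sum.cong)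
          moreover have "(\<Sum>u\<in>S. c u * \<psi> u p * \<psi> u q) - (\<Sum>u\<in>S. c u * \<psi> u p) * \<psi> t q
              = (c t * \<psi> t p * \<psi> t q + (\<Sum>u\<in>S. c u * \<psi> u p * \<psi> u q))
                - (c t * \<psi> t p + (\<Sum>u\<in>S. c u * \<psi> u p)) * \<psi> t q"
            by (simp add: distrib_right)
          ultimately have "(\<Sum>u\<in>S. c u * \<psi> u p * \<psi> u q) - (\<Sum>u\<in>S. c u * \<psi> u p) * \<psi> t q = 0"
            by simp
          then show ?thesis
            by (simp add: sum_distrib_left sum_subtractf algebra_simps)
        qed
        from IH[OF this s] show ?thesis
          using q by simp
      qed
      moreover have "c t = 0"
        using c P(1) insert.hyps insert.prems(1) zero by (auto dest!: bspec[of _ _ e])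
      ultimately show "\<forall>s\<in>insert t S. c s = 0" by simp
    qed
  qed simp
  with vanish \<open>s \<in> S\<close> show ?thesis by blast
qed

text \<open>
  Setting the variable in which the exponents differ to 2 and the others to 1 suffices.
\<close>

lemma exponent_eval_separates:
  assumes "m \<noteq> n"
  obtains h :: "'g \<Rightarrow> complex" where "exponent_eval h m \<noteq> exponent_eval h n"
proof -
  have "\<exists>g. Poly_Mapping.lookup m g \<noteq> Poly_Mapping.lookup n g"
    by (rule ccontr) (use poly_mapping_eqI[of m n] assms in simp)
  then obtain g where g: "Poly_Mapping.lookup m g \<noteq> Poly_Mapping.lookup n g" ..
  let ?h = "\<lambda>x. if x = g then 2 else 1 :: complex"
  have "exponent_eval ?h k = 2 ^ Poly_Mapping.lookup k g" for k
  proof -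
    have "exponent_eval ?h k = (\<Prod>x\<in>insert g (Poly_Mapping.keys k). ?h x ^ Poly_Mapping.lookup k x)"
      by (rule exponent_eval_superset) auto
    also have "\<dots> = (\<Prod>x\<in>{g}. ?h x ^ Poly_Mapping.lookup k x)"
      by (rule prod.mono_neutral_right) auto
    finally show ?thesis by simp
  qed
  moreover have "(2 :: complex) ^ k = 2 ^ l \<longleftrightarrow> k = l" for k l
    using power_inject_exp[of "2 :: nat" k l] of_nat_eq_iff[of "2 ^ k" "2 ^ l", where ?'a = complex]
    by simp
  ultimately show ?thesis
    using g that by metis
qed

text \<open>
  Evaluation of a monomial is multiplicative in the point, so a nonzero polynomial that vanished
  everywhere would be a linear relation between distinct characters.
\<close>

lemma polynomial_eq_if_eval_eq:
  fixes x y :: "('g \<Rightarrow>\<^sub>0 nat) \<Rightarrow>\<^sub>0 complex"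
  assumes "\<And>\<rho>. monoid_eval (\<lambda>c. c) (exponent_eval \<rho>) x = monoid_eval (\<lambda>c. c) (exponent_eval \<rho>) y"
  shows "x = y"
proof -
  have "Poly_Mapping.lookup (x - y) m = 0" if m: "m \<in> Poly_Mapping.keys (x - y)" for m
  proof (rule independence_of_characters[where P = UNIV and S = "Poly_Mapping.keys (x - y)"
        and \<psi> = "\<lambda>m \<rho>. exponent_eval \<rho> m" and e = "\<lambda>_. 1" and opn = "\<lambda>\<rho> \<sigma> g. \<rho> g * \<sigma> g"])
    fix \<rho> :: "'g \<Rightarrow> complex"
    interpret ring_morphism "monoid_eval (\<lambda>c. c) (exponent_eval \<rho>)"
      by (rule ring_morphism_monoid_eval) (simp_all add: ring_morphism_id exponent_eval_0 exponent_eval_add)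
    show "(\<Sum>m\<in>Poly_Mapping.keys (x - y). Poly_Mapping.lookup (x - y) m * exponent_eval \<rho> m) = 0"
      using assms[of \<rho>] diff[of x y] unfolding monoid_eval_def by simp
    show "\<exists>\<rho>\<in>UNIV :: ('g \<Rightarrow> complex) set. exponent_eval \<rho> k \<noteq> exponent_eval \<rho> l" if "k \<noteq> l" for k l :: "'g \<Rightarrow>\<^sub>0 nat"
      by (rule exponent_eval_separates[OF that]) (erule bexI[OF _ UNIV_I])
  qed (use m in \<open>simp_all add: exponent_eval_mult\<close>, simp add: exponent_eval_def)
  then have "Poly_Mapping.keys (x - y) = {}"
    using in_keys_iff by blast
  then have "x - y = 0"
    using sum_singles[of "x - y"] by simp
  then show ?thesis by simp
qed

section \<open>Logarithms, translations and Borel transforms of power series\<close>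

definition fps_log :: "complex fps \<Rightarrow> complex fps" where
  "fps_log F = fps_compose (fps_ln 1) (F - 1)"

lemma fps_log_nth_0: "fps_nth (fps_log F) 0 = 0"
  by (simp add: fps_log_def)

lemma fps_log_deriv:
  assumes "fps_nth F 0 = 1"
  shows "fps_deriv (fps_log F) = fps_deriv F * inverse F"
proof -
  have 0: "fps_nth (F - 1) 0 = 0"
    using assms by simp
  have "fps_compose (1 + fps_X) (F - 1) = F"
    using assms by (intro fps_ext) (simp add: fps_compose_add_distrib fps_X_fps_compose)
  then have "fps_compose (inverse (1 + fps_X)) (F - 1) = inverse F"
    using fps_inverse_compose[OF 0, of "1 + fps_X"] by simp
  then show ?thesis
    by (simp add: fps_log_def fps_compose_deriv[OF 0] fps_ln_deriv mult.commute)
qed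

lemma fps_eqI_deriv:
  fixes F G :: "complex fps"
  assumes "fps_deriv F = fps_deriv G" "fps_nth F 0 = fps_nth G 0"
  shows "F = G"
  using assms fps_deriv_eq_iff[of F G] by simp

lemma fps_log_one: "fps_log 1 = 0"
  by (rule fps_eqI_deriv) (simp_all add: fps_log_deriv fps_log_nth_0)

text \<open>
  Both sides vanish at 0 and have the same derivative, since the logarithmic derivative is
  additive.
\<close>

lemma fps_log_mult:
  assumes F: "fps_nth F 0 = 1" and G: "fps_nth G 0 = 1"
  shows "fps_log (F * G) = fps_log F + fps_log G"
proof (rule fps_eqI_deriv)
  have "F * inverse F = 1" "G * inverse G = 1"
    using F G by (simp_all add: inverse_mult_eq_1')
  then have "(fps_deriv F * G + F * fps_deriv G) * (inverse F * inverse G)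
      = fps_deriv F * inverse F + fps_deriv G * inverse G"
    by (metis (no_types, opaque_lifting) distrib_right mult.assoc mult.commute mult.right_neutral)
  then show "fps_deriv (fps_log (F * G)) = fps_deriv (fps_log F + fps_log G)"
    using F G by (simp add: fps_log_deriv fps_inverse_mult add.commute)
qed (simp add: fps_log_nth_0)

lemma fps_prod_nth_0:
  fixes F :: "'k \<Rightarrow> 'a::comm_ring_1 fps"
  shows "(\<And>k. k \<in> A \<Longrightarrow> fps_nth (F k) 0 = 1) \<Longrightarrow> fps_nth (prod F A) 0 = 1"
  by (induction A rule: infinite_finite_induct) auto

lemma fps_log_prod:
  "(\<And>k. k \<in> A \<Longrightarrow> fps_nth (F k) 0 = 1) \<Longrightarrow> fps_log (prod F A) = (\<Sum>k\<in>A. fps_log (F k))"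
  by (induction A rule: infinite_finite_induct) (simp_all add: fps_log_one fps_log_mult fps_prod_nth_0)

text \<open>
  Covers the exponent $-1$ that the braid operator has for \<open>i = j\<close>.
\<close>

lemma fps_log_inverse:
  assumes "fps_nth F 0 = 1" "fps_nth G 0 = 1" "F * G = 1"
  shows "fps_log G = - fps_log F"
  using fps_log_mult[OF assms(1,2)] assms(3) by (simp add: fps_log_one eq_neg_iff_add_eq_0 add.commute)

lemma fps_log_compose:
  assumes "fps_nth F 0 = 1" "fps_nth S 0 = 0"
  shows "fps_log (fps_compose F S) = fps_compose (fps_log F) S"
proof -
  have "fps_compose F S - 1 = fps_compose (F - 1) S"
    by (simp add: fps_compose_sub_distrib)
  then show ?thesis
    using assms by (simp add: fps_log_def fps_compose_assoc)
qed

text \<open>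
  Lets a character be prescribed through its logarithms.
\<close>

lemma fps_log_exp:
  assumes "fps_nth G 0 = 0"
  shows "fps_log (fps_compose (fps_exp 1) G) = G"
proof -
  have "fps_compose (fps_exp 1) G - 1 = fps_compose (fps_exp 1 - 1) G"
    by (simp add: fps_compose_sub_distrib)
  then have "fps_log (fps_compose (fps_exp 1) G)
      = fps_compose (fps_compose (fps_ln 1) (fps_exp 1 - 1)) G"
    using assms by (simp add: fps_log_def fps_compose_assoc)
  also have "fps_compose (fps_ln 1) (fps_exp 1 - 1) = (fps_X :: complex fps)"
    by (simp add: fps_ln_fps_exp_inv fps_inv_fps_exp_compose)
  finally show ?thesis
    using assms by (simp add: fps_eq_iff fps_X_fps_compose)
qed

text \<open>
  The expansion of $(u-s)^{-1}$ in the variable $u^{-1}$; composing with it replaces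
  \<open>u\<close> by \<open>u - s\<close>.
\<close>

definition translation :: "complex \<Rightarrow> complex fps" where
  "translation s = Abs_fps (\<lambda>n. if n = 0 then 0 else s ^ (n - 1))"

lemma translation_nth_0 [simp]: "fps_nth (translation s) 0 = 0"
  by (simp add: translation_def)

lemma translation_recursion: "translation s = fps_X + fps_const s * fps_X * translation s"
  by (rule fps_ext)
     (auto simp: translation_def mult.assoc power_Suc[symmetric] Suc_diff_Suc gr0_conv_Suc
       simp del: power_Suc)

text \<open>
  The negative binomial series for $(u-s)^{-m-1}$. The recursion for \<open>translation\<close>
  turns into Pascal's rule for the coefficients.
\<close>

lemma translation_power_nth:
  "fps_nth (translation s ^ Suc m) (Suc n) = of_nat (n choose m) * s ^ (n - m)"
proof (induction m arbitrary: n)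
  case 0
  then show ?case by (simp add: translation_def)
next
  case (Suc m)
  note IH_m = Suc.IH
  have rec: "translation s ^ Suc (Suc m)
      = fps_X * (translation s ^ Suc m + fps_const s * translation s ^ Suc (Suc m))"
    by (subst (1) power_Suc, subst (1) translation_recursion) (simp add: algebra_simps)
  show ?case
  proof (induction n)
    case 0
    then show ?case
      by (subst rec) simp
  next
    case (Suc n)
    have "fps_nth (translation s ^ Suc (Suc m)) (Suc (Suc n))
        = fps_nth (translation s ^ Suc m) (Suc n)
          + s * fps_nth (translation s ^ Suc (Suc m)) (Suc n)"
      by (subst rec) (simp add: fps_X_mult_nth del: power_Suc)
    also have "\<dots> = of_nat (n choose m) * s ^ (n - m)
        + s * (of_nat (n choose Suc m) * s ^ (n - Suc m))"
      by (simp only: Suc.IH IH_m)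
    also have "s * (of_nat (n choose Suc m) * s ^ (n - Suc m))
        = of_nat (n choose Suc m) * s ^ (n - m)"
    proof (cases "m < n")
      case True
      then have "n - m = Suc (n - Suc m)" by simp
      then show ?thesis by (simp add: mult_ac)
    qed (simp add: binomial_eq_0)
    finally show ?case by (simp add: distrib_right)
  qed
qed

text \<open>
  Sends $\sum_n F_n u^{-n}$ to $\sum_n F_{n+1} z^n/n!$ at $z = cv$, as a series in
  \<open>v\<close>: the constant term is discarded, and $u^{-n-1}$ corresponds to $z^n/n!$.
\<close>

definition borel_transform :: "complex \<Rightarrow> complex fps \<Rightarrow> complex fps" where
  "borel_transform c F = Abs_fps (\<lambda>n. c ^ n / fact n * fps_nth F (Suc n))"

lemma borel_transform_add: "borel_transform c (F + G) = borel_transform c F + borel_transform c G"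
  by (rule fps_ext) (simp add: borel_transform_def distrib_left)

lemma borel_transform_uminus: "borel_transform c (- F) = - borel_transform c F"
  by (rule fps_ext) (simp add: borel_transform_def)

lemma borel_transform_sum: "borel_transform c (sum F A) = (\<Sum>k\<in>A. borel_transform c (F k))"
  by (rule fps_ext) (simp add: borel_transform_def fps_sum_nth sum_distrib_left)

text \<open>
  In the coefficient of \<open>v\<^sup>n\<close>, the binomial coefficient cancels against the
  factorials and leaves the Cauchy product with the exponential series.
\<close>

lemma borel_transform_translation:
  "borel_transform c (fps_compose F (translation s)) = fps_exp (c * s) * borel_transform c F"
proof (rule fps_ext)
  fix n
  have "c ^ n / fact n * fps_nth (fps_compose F (translation s)) (Suc n)
      = (\<Sum>m\<le>n. c ^ n / fact n * (fps_nth F (Suc m) * (of_nat (n choose m) * s ^ (n - m))))"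
    by (simp add: fps_compose_nth atLeast0AtMost sum.atMost_Suc_shift translation_power_nth
        sum_distrib_left del: power_Suc sum.atMost_Suc sum.cl_ivl_Suc)
  also have "\<dots> = (\<Sum>m\<le>n. c ^ m / fact m * fps_nth F (Suc m) * ((c * s) ^ (n - m) / fact (n - m)))"
  proof (rule sum.cong)
    fix m assume "m \<in> {..n}"
    then have m: "m \<le> n" by simp
    then have "c ^ n = c ^ m * c ^ (n - m)"
      by (simp flip: power_add)
    then show "c ^ n / fact n * (fps_nth F (Suc m) * (of_nat (n choose m) * s ^ (n - m)))
        = c ^ m / fact m * fps_nth F (Suc m) * ((c * s) ^ (n - m) / fact (n - m))"
      using m by (simp add: binomial_fact power_mult_distrib)
  qed simp
  finally show "fps_nth (borel_transform c (fps_compose F (translation s))) n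
      = fps_nth (fps_exp (c * s) * borel_transform c F) n"
    by (subst mult.commute) (simp add: borel_transform_def fps_mult_nth atLeast0AtMost)
qed

text \<open>
  The terms telescope; with $e^t$ as $q_j^r$ this is $q_j^r$ times the numerator of a quantum
  integer.
\<close>

lemma fps_exp_geometric_sum:
  "(\<Sum>k<m. fps_exp (t * (of_nat m - 2 * of_nat k))) * (fps_exp t - fps_exp (- t))
     = fps_exp t * (fps_exp (of_nat m * t) - fps_exp (- (of_nat m * t :: complex)))"
proof -
  let ?g = "\<lambda>k. fps_exp (t * (of_nat m - 2 * of_nat k + 1))"
  have "fps_exp (t * (of_nat m - 2 * of_nat k)) * (fps_exp t - fps_exp (- t)) = ?g k - ?g (Suc k)" for k
    by (simp add: right_diff_distrib algebra_simps flip: fps_exp_add_mult)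
  then have "(\<Sum>k<m. fps_exp (t * (of_nat m - 2 * of_nat k))) * (fps_exp t - fps_exp (- t))
      = (\<Sum>k<m. ?g k - ?g (Suc k))"
    by (simp add: sum_distrib_right)
  also have "\<dots> = ?g 0 - ?g m"
    by (rule sum_lessThan_telescope')
  also have "\<dots> = fps_exp t * (fps_exp (of_nat m * t) - fps_exp (- (of_nat m * t)))"
    by (simp add: right_diff_distrib algebra_simps flip: fps_exp_add_mult)
  finally show ?thesis .
qed

section \<open>The algebra of the $K_i$ and $h_{i,r}$\<close>

definition U0_mon_eval ::
    "('i::finite \<Rightarrow> 'b::comm_ring_1) \<Rightarrow> ('i \<Rightarrow> 'b) \<Rightarrow> ('i \<Rightarrow> nzint \<Rightarrow> 'b) \<Rightarrow> 'i U0_mon \<Rightarrow> 'b" where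
  "U0_mon_eval k k' h m =
     (\<Prod>i\<in>UNIV. signed_power (k i) (k' i) (Poly_Mapping.lookup (fst m) i)) *
     exponent_eval (case_prod h) (snd m)"

lemma U0_eval_eq_monoid_eval: "U0_eval \<phi> k k' h = monoid_eval \<phi> (U0_mon_eval k k' h)"
  by (simp add: fun_eq_iff U0_eval_def monoid_eval_def U0_mon_eval_def signed_power_def
      exponent_eval_def case_prod_unfold mult.assoc)

lemma U0_mon_eval_0: "U0_mon_eval k k' h 0 = 1"
  by (simp add: U0_mon_eval_def exponent_eval_0)

lemma U0_mon_eval_add:
  assumes "\<And>i. k i * k' i = 1"
  shows "U0_mon_eval k k' h (m + n) = U0_mon_eval k k' h m * U0_mon_eval k k' h n"
  by (simp add: U0_mon_eval_def lookup_add signed_power_add[OF assms] prod.distrib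
      exponent_eval_add mult_ac)

lemma ring_morphism_U0_eval:
  assumes "ring_morphism \<phi>" "\<And>i. k i * k' i = 1"
  shows "ring_morphism (U0_eval \<phi> k k' h)"
  unfolding U0_eval_eq_monoid_eval
  by (rule ring_morphism_monoid_eval[OF assms(1)])
     (simp_all add: U0_mon_eval_0 U0_mon_eval_add assms(2))

lemma U0_eval_scalar:
  assumes "ring_morphism \<phi>"
  shows "U0_eval \<phi> k k' h (U0_scalar c) = \<phi> c"
  using ring_morphism.zero[OF assms]
  by (simp add: U0_eval_eq_monoid_eval U0_scalar_def monoid_eval_single U0_mon_eval_0)

lemma prod_one_point:
  fixes f :: "'i::finite \<Rightarrow> 'b::comm_monoid_mult"
  assumes "\<And>l. l \<noteq> i \<Longrightarrow> f l = 1"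
  shows "(\<Prod>l\<in>UNIV. f l) = f i"
  using prod.mono_neutral_right[of UNIV "{i}" f] assms by auto

lemma U0_eval_K:
  assumes "ring_morphism \<phi>"
  shows "U0_eval \<phi> k k' h (U0_K i n) = signed_power (k i) (k' i) n"
  using ring_morphism.zero[OF assms] ring_morphism.one[OF assms]
  by (simp add: U0_eval_eq_monoid_eval U0_K_def monoid_eval_single U0_mon_eval_def exponent_eval_0
      prod_one_point[of i] lookup_single_not_eq)

lemma U0_eval_h:
  assumes "ring_morphism \<phi>"
  shows "U0_eval \<phi> k k' h (U0_h i r) = h i r"
  using ring_morphism.zero[OF assms] ring_morphism.one[OF assms]
  by (simp add: U0_eval_eq_monoid_eval U0_h_def monoid_eval_single U0_mon_eval_def
      exponent_eval_single del: One_nat_def)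

lemma ring_morphism_U0_eval_apply:
  assumes "ring_morphism f"
  shows "f (U0_eval \<phi> k k' h x)
    = U0_eval (\<lambda>c. f (\<phi> c)) (\<lambda>i. f (k i)) (\<lambda>i. f (k' i)) (\<lambda>i r. f (h i r)) x"
proof -
  interpret ring_morphism f by fact
  show ?thesis
    unfolding U0_eval_def sum mult prod if_distrib[of f] power ..
qed

lemma U0_K_add: "U0_K i (m + n) = U0_K i m * U0_K i n"
  by (simp add: U0_K_def mult_single single_add)

lemma U0_K_0: "U0_K i 0 = 1"
  by (simp add: U0_K_def flip: single_one zero_prod_def)

lemma U0_K_inverse: "U0_K i n * U0_K i (- n) = 1"
  using U0_K_add[of i n "- n"] by (simp add: U0_K_0)

lemma signed_power_U0_K: "signed_power (U0_K i m) (U0_K i (- m)) n = U0_K i (m * n)"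
proof -
  have "U0_K i m ^ k = U0_K i (m * int k)" for m k
    by (induction k) (simp_all add: U0_K_0 distrib_left flip: U0_K_add)
  then show ?thesis
    by (simp add: signed_power_def)
qed

lemma signed_power_U0_K_1: "signed_power (U0_K i 1) (U0_K i (-1)) n = U0_K i n"
  using signed_power_U0_K[of i 1 n] by simp

lemma prod_single:
  "(\<Prod>i\<in>A. Poly_Mapping.single (f i) (1 :: 'c::comm_semiring_1)) = Poly_Mapping.single (\<Sum>i\<in>A. f i) 1"
  by (induction A rule: infinite_finite_induct) (simp_all add: mult_single)

lemma single_power:
  "Poly_Mapping.single (m :: 'm::comm_monoid_add) (1 :: 'c::comm_semiring_1) ^ n
     = Poly_Mapping.single (\<Sum>_<n. m) 1"
  using prod_single[of "\<lambda>_. m" "{..<n}"] by (simp add: prod_constant)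

text \<open>
  Shows that the \<open>K\<^sub>i\<close>, their inverses and the
  \<open>h\<^sub>i\<^sub>,\<^sub>r\<close> generate, so that a ring homomorphism is an evaluation
  at its values on them.
\<close>

lemma U0_mon_eval_generators:
  "U0_mon_eval (\<lambda>i. U0_K i 1) (\<lambda>i. U0_K i (-1)) U0_h m = Poly_Mapping.single m 1"
proof -
  have K: "(\<Prod>i\<in>UNIV. signed_power (U0_K i 1) (U0_K i (-1)) (Poly_Mapping.lookup (fst m) i))
      = Poly_Mapping.single (fst m, 0) 1"
  proof -
    have "(\<Sum>i\<in>UNIV. (Poly_Mapping.single i (Poly_Mapping.lookup (fst m) i), 0 :: ('a \<times> nzint) \<Rightarrow>\<^sub>0 nat))
        = (fst m, 0)"
    proof -
      have "(\<Sum>i\<in>UNIV. (Poly_Mapping.single i (Poly_Mapping.lookup (fst m) i), 0 :: ('a \<times> nzint) \<Rightarrow>\<^sub>0 nat))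
          = (\<Sum>i\<in>UNIV. Poly_Mapping.single i (Poly_Mapping.lookup (fst m) i), 0)"
        by (simp add: prod_eq_iff fst_sum snd_sum)
      also have "(\<Sum>i\<in>UNIV. Poly_Mapping.single i (Poly_Mapping.lookup (fst m) i)) = fst m"
        by (rule poly_mapping_eqI) (simp add: lookup_sum lookup_single when_def)
      finally show ?thesis .
    qed
    then show ?thesis
      unfolding signed_power_U0_K_1 by (simp add: U0_K_def prod_single)
  qed
  have h: "exponent_eval (case_prod U0_h) n = Poly_Mapping.single (0, n) 1" for n :: "('a \<times> nzint) \<Rightarrow>\<^sub>0 nat"
  proof -
    have "(\<Sum>g\<in>Poly_Mapping.keys n. \<Sum>_<Poly_Mapping.lookup n g.
        (0 :: 'a \<Rightarrow>\<^sub>0 int, Poly_Mapping.single g (1::nat))) = (0, n)"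
    proof -
      have *: "(\<Sum>_<k. Poly_Mapping.single g (1::nat)) = Poly_Mapping.single g k" for k and g :: "'a \<times> nzint"
        by (induction k) (simp_all flip: single_add)
      show ?thesis
        using sum_singles[of n] by (simp add: prod_eq_iff fst_sum snd_sum * del: One_nat_def)
    qed
    then show ?thesis
      by (simp add: exponent_eval_def U0_h_def case_prod_unfold single_power prod_single)
  qed
  show ?thesis
    by (simp add: U0_mon_eval_def K h mult_single)
qed

lemma ring_morphism_U0_scalar: "ring_morphism U0_scalar"
  by standard (simp_all add: U0_scalar_def mult_single single_add)

lemma U0_eval_generators:
  fixes x :: "'i::finite U0"
  shows "U0_eval U0_scalar (\<lambda>i. U0_K i 1) (\<lambda>i. U0_K i (-1)) U0_h x = x"
proof (rule additive_ext[where f = "U0_eval U0_scalar (\<lambda>i. U0_K i 1) (\<lambda>i. U0_K i (-1)) U0_h" and x = x])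
  show "U0_eval U0_scalar (\<lambda>i. U0_K i 1) (\<lambda>i. U0_K i (-1)) U0_h (Poly_Mapping.single m c)
      = Poly_Mapping.single m c" for m c
    by (simp add: U0_eval_eq_monoid_eval monoid_eval_single U0_mon_eval_generators
        U0_scalar_def mult_single)
qed (simp_all add: U0_eval_eq_monoid_eval monoid_eval_add[OF ring_morphism_U0_scalar])

text \<open>
  Inverses in a commutative ring are unique, so agreement on $K_i$ forces agreement on $K_i^{-1}$.
\<close>

lemma U0_hom_ext:
  fixes f g :: "'i::finite U0 \<Rightarrow> 'b::comm_ring_1"
  assumes f: "ring_morphism f" and g: "ring_morphism g"
    and scalar: "\<And>c. f (U0_scalar c) = g (U0_scalar c)"
    and K: "\<And>i. f (U0_K i 1) = g (U0_K i 1)"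
    and h: "\<And>i r. f (U0_h i r) = g (U0_h i r)"
  shows "f x = g x"
proof -
  have inv: "f (U0_K i 1) * f (U0_K i (-1)) = 1" "g (U0_K i 1) * g (U0_K i (-1)) = 1" for i
    using U0_K_inverse[of i 1] ring_morphism.mult[OF f] ring_morphism.one[OF f]
      ring_morphism.mult[OF g] ring_morphism.one[OF g] by metis+
  have "f (U0_K i (-1)) = g (U0_K i (-1))" for i
  proof -
    have "f (U0_K i (-1)) = f (U0_K i (-1)) * (g (U0_K i 1) * g (U0_K i (-1)))"
      by (simp add: inv)
    also have "\<dots> = (f (U0_K i 1) * f (U0_K i (-1))) * g (U0_K i (-1))"
      by (simp add: K mult_ac)
    finally show ?thesis by (simp add: inv)
  qed
  then show ?thesis
    using ring_morphism_U0_eval_apply[OF f, of U0_scalar "\<lambda>i. U0_K i 1" "\<lambda>i. U0_K i (-1)" U0_h x]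
      ring_morphism_U0_eval_apply[OF g, of U0_scalar "\<lambda>i. U0_K i 1" "\<lambda>i. U0_K i (-1)" U0_h x]
    by (simp add: U0_eval_generators scalar K h)
qed

section \<open>Quantum integers\<close>

lemma qpow_add: "qpow (m + n) = qpow m * qpow n"
  by (simp add: qpow_def mult_single)

lemma qpow_0: "qpow 0 = 1"
  by (simp add: qpow_def)

lemma qpow_diff_nonzero:
  assumes "m \<noteq> 0"
  shows "qpow m - qpow (- m) \<noteq> 0"
proof -
  have "Poly_Mapping.lookup (qpow m - qpow (- m)) m = 1"
    using assms by (simp add: qpow_def lookup_minus lookup_single)
  then show ?thesis by auto
qed

lemma exact_quot_mult: "y \<noteq> 0 \<Longrightarrow> exact_quot (z * y) y = z"
  unfolding exact_quot_def by (rule the_equality) simp_all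

text \<open>
  The division in a quantum integer is exact: the numerators for \<open>n\<close> and \<open>n +
  1\<close> differ, up to the unit \<open>qpow m\<close>, by a multiple of the denominator.
\<close>

lemma qint_mult:
  assumes "m \<noteq> 0"
  shows "qint m n * (qpow m - qpow (- m)) = qpow (m * n) - qpow (- (m * n))"
proof -
  have "(qpow m - qpow (- m)) dvd (qpow (m * n) - qpow (- (m * n)))"
  proof (induction n rule: int_induct[where k = 0])
    case (step1 n)
    have "qpow (m * (n + 1)) - qpow (- (m * (n + 1)))
        = qpow m * (qpow (m * n) - qpow (- (m * n))) + (qpow m - qpow (- m)) * qpow (- (m * n))"
      by (simp add: algebra_simps flip: qpow_add)
    with step1 show ?case by simp
  next
    case (step2 n)
    have "qpow (m * (n - 1)) - qpow (- (m * (n - 1)))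
        = qpow (- m) * (qpow (m * n) - qpow (- (m * n))) - (qpow m - qpow (- m)) * qpow (- (m * n))"
      by (simp add: algebra_simps flip: qpow_add)
    with step2 show ?case by simp
  qed simp
  then obtain z where "qpow (m * n) - qpow (- (m * n)) = (qpow m - qpow (- m)) * z"
    by (rule dvdE)
  then show ?thesis
    using exact_quot_mult[OF qpow_diff_nonzero[OF assms], of z] by (simp add: qint_def mult.commute)
qed

text \<open>
  A quotient of quantum integers is again one, with $q^m$ replaced by $q^{mr}$: the common
  denominator $q^m - q^{-m}$ cancels.
\<close>

lemma exact_quot_qint:
  assumes "m \<noteq> 0" "r \<noteq> 0"
  shows "exact_quot (qint m (r * n)) (qint m r) = qint (m * r) n"
proof -
  let ?D = "qpow m - qpow (- m)"
  have D: "?D \<noteq> 0" by (rule qpow_diff_nonzero) fact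
  have "qint m (r * n) * ?D = qint (m * r) n * qint m r * ?D"
    using qint_mult[of "m * r" n] qint_mult[OF assms(1), of r] qint_mult[OF assms(1), of "r * n"] assms
    by (simp add: mult.assoc)
  then have "qint m (r * n) = qint (m * r) n * qint m r"
    using D by simp
  moreover have "qint m r \<noteq> 0"
    using qint_mult[OF assms(1), of r] qpow_diff_nonzero[of "m * r"] assms by auto
  ultimately show ?thesis
    by (simp add: exact_quot_mult)
qed

lemma qint_2:
  assumes "m \<noteq> 0"
  shows "qint m 2 = qpow m + qpow (- m)"
proof -
  have "qint m 2 * (qpow m - qpow (- m)) = (qpow m + qpow (- m)) * (qpow m - qpow (- m))"
    unfolding qint_mult[OF assms] by (simp add: algebra_simps flip: qpow_add)
  then show ?thesis
    using qpow_diff_nonzero[OF assms] by simp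
qed

text \<open>
  The structure map $q\mapsto e^{v/2}$ with values in $\mathbb C[[v]]$, before embedding the
  scalars in \<open>Y\<^sup>0\<close>.
\<close>

definition q_series :: "laurent \<Rightarrow> complex fps" where
  "q_series = monoid_eval fps_const (\<lambda>n. fps_exp (of_int n / 2))"

lemma laurent_to_series_eq: "laurent_to_series c = Y0_emb (q_series c)"
  by (simp add: laurent_to_series_def q_series_def monoid_eval_def)

lemma ring_morphism_q_series: "ring_morphism q_series"
  unfolding q_series_def
proof (rule ring_morphism_monoid_eval)
  show "ring_morphism (fps_const :: complex \<Rightarrow> _)"
    by standard simp_all
qed (simp_all add: add_divide_distrib fps_exp_add_mult)

lemma q_series_qpow: "q_series (qpow n) = fps_exp (of_int n / 2)"
  by (simp add: q_series_def qpow_def monoid_eval_single)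

text \<open>
  The coefficient of \<open>v\<^sup>k\<close> is, up to \<open>k!\<close>, the combination of the
  powers $(n/2)^k$, and these are distinct characters of the additive monoid of the
  \<open>k\<close> as \<open>n\<close> varies.
\<close>

lemma q_series_inject_zero:
  assumes "q_series c = 0"
  shows "c = 0"
proof -
  have "Poly_Mapping.lookup c n = 0" if n: "n \<in> Poly_Mapping.keys c" for n
  proof (rule independence_of_characters[where P = UNIV and S = "Poly_Mapping.keys c"
        and \<psi> = "\<lambda>n k. (of_int n / 2) ^ k" and e = 0 and opn = "(+) :: nat \<Rightarrow> _"])
    fix k :: nat
    have "fps_nth (q_series c) k = 0"
      using assms by simp
    then have "(\<Sum>n\<in>Poly_Mapping.keys c. Poly_Mapping.lookup c n * (of_int n / 2) ^ k) / fact k = 0"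
      by (simp add: q_series_def monoid_eval_def fps_sum_nth sum_divide_distrib)
    then show "(\<Sum>n\<in>Poly_Mapping.keys c. Poly_Mapping.lookup c n * (of_int n / 2) ^ k) = 0"
      by simp
    show "\<exists>k\<in>UNIV. (complex_of_int m / 2) ^ k \<noteq> (of_int n / 2) ^ k" if "m \<noteq> n" for m n
      using that by (intro bexI[of _ 1]) auto
  qed (use n in \<open>simp_all add: power_add\<close>)
  then have "Poly_Mapping.keys c = {}"
    using in_keys_iff by blast
  then show ?thesis
    using sum_singles[of c] by simp
qed

section \<open>Characters of $Y^0$\<close>

definition fps_map :: "('a \<Rightarrow> 'b) \<Rightarrow> 'a fps \<Rightarrow> 'b fps" where
  "fps_map f F = Abs_fps (\<lambda>n. f (fps_nth F n))"

lemma fps_map_nth [simp]: "fps_nth (fps_map f F) n = f (fps_nth F n)"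
  by (simp add: fps_map_def)

lemma ring_morphism_fps_map:
  assumes "ring_morphism f"
  shows "ring_morphism (fps_map f)"
proof -
  interpret ring_morphism f by fact
  show ?thesis
    by standard (simp_all add: fps_eq_iff fps_mult_nth one zero add mult sum)
qed

lemma fps_map_compose:
  assumes "ring_morphism f"
  shows "fps_map f (fps_compose F G) = fps_compose (fps_map f F) (fps_map f G)"
proof -
  interpret ring_morphism f by fact
  interpret hat: ring_morphism "fps_map f" by (rule ring_morphism_fps_map) fact
  show ?thesis
    by (rule fps_ext) (simp add: fps_compose_nth sum mult flip: hat.power)
qed

lemma ring_morphism_Y0_scalar: "ring_morphism Y0_scalar"
  by standard (simp_all add: Y0_scalar_def mult_single single_add)

lemma Y0_subst_eq_monoid_eval: "Y0_subst g = monoid_eval Y0_scalar (exponent_eval (case_prod g))"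
  by (simp add: fun_eq_iff Y0_subst_def monoid_eval_def exponent_eval_def case_prod_unfold)

lemma ring_morphism_Y0_subst: "ring_morphism (Y0_subst g)"
  unfolding Y0_subst_eq_monoid_eval
  by (rule ring_morphism_monoid_eval)
     (simp_all add: ring_morphism_Y0_scalar exponent_eval_0 exponent_eval_add)

lemma Y0_subst_scalar: "Y0_subst g (Y0_scalar c) = Y0_scalar c"
  using ring_morphism.zero[OF ring_morphism_Y0_scalar]
  by (simp add: Y0_subst_eq_monoid_eval monoid_eval_single exponent_eval_0 Y0_scalar_def)

locale Y0_character = ring_morphism \<psi> for \<psi> :: "'i Y0 \<Rightarrow> complex" +
  assumes scalar: "\<psi> (Y0_scalar c) = c"
begin

sublocale hat: ring_morphism "fps_map \<psi>"
  by (rule ring_morphism_fps_map) (rule ring_morphism_axioms)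

lemma hat_emb: "fps_map \<psi> (Y0_emb f) = f"
  by (rule fps_ext) (simp add: Y0_emb_def scalar)

lemma hat_exp_v: "fps_map \<psi> (Y0_exp_v y) = fps_exp (\<psi> y)"
  by (rule fps_ext) (simp add: Y0_exp_v_def scalar mult power)

lemma hat_xi_series_nth_0: "fps_nth (fps_map \<psi> (xi_series hbar i)) 0 = 1"
  by (simp add: xi_series_def one zero add)

lemma hat_log_xi_series:
  "fps_map \<psi> (log_xi_series hbar i) = fps_log (fps_map \<psi> (xi_series hbar i))"
  by (simp add: log_xi_series_def fps_map_compose[OF ring_morphism_axioms] hat_emb hat.diff hat.one
      fps_log_def)

lemma hat_borel_series:
  assumes "hbar \<noteq> 0"
  shows "fps_map \<psi> (borel_series hbar i c) = borel_transform c (fps_log (fps_map \<psi> (xi_series hbar i)))"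
  using assms
  by (intro fps_ext) (simp add: borel_series_def Y0_t_def mult scalar borel_transform_def flip: hat_log_xi_series)

lemma hat_shift_series: "fps_map \<psi> (shift_series c F) = fps_compose (fps_map \<psi> F) (translation c)"
  by (simp add: shift_series_def fps_map_compose[OF ring_morphism_axioms] hat_emb translation_def)

text \<open>
  $\xi_{i,0}$ and $t_{i,0}$ coincide, because \<open>log (1 + X)\<close> begins with
  \<open>X\<close>.
\<close>

lemma xi_0:
  assumes "hbar \<noteq> 0"
  shows "\<psi> (Y0_xi i 0) = fps_nth (fps_log (fps_map \<psi> (xi_series hbar i))) 1 / hbar"
proof -
  let ?F = "fps_map \<psi> (xi_series hbar i)"
  have "fps_nth (fps_log ?F) 1 = fps_nth (fps_deriv (fps_log ?F)) 0"
    by simp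
  also have "\<dots> = fps_nth ?F 1"
    unfolding fps_log_deriv[OF hat_xi_series_nth_0] by (simp add: hat_xi_series_nth_0 del: fps_map_nth)
  also have "\<dots> = hbar * \<psi> (Y0_xi i 0)"
    by (simp add: xi_series_def mult add scalar zero)
  finally show ?thesis using assms by simp
qed

text \<open>
  The image of \<open>h\<^sub>i\<^sub>,\<^sub>r\<close> under \<open>\<Phi>\<close> followed by
  the character, see \<open>hat_Phi_h\<close>.
\<close>

definition h_value :: "complex \<Rightarrow> ('i \<Rightarrow> nat) \<Rightarrow> 'i \<Rightarrow> nzint \<Rightarrow> complex fps" where
  "h_value hbar d i r =
     (let s = of_int (int (d i) * int_of_nzint r) / 2 in
        (fps_X / (fps_exp s - fps_exp (- s))) *
        borel_transform (of_int (int_of_nzint r) / hbar) (fps_log (fps_map \<psi> (xi_series hbar i))))"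

end

text \<open>
  \<open>\<Phi>\<close> is an evaluation, and a ring homomorphism applied to an evaluation is the
  evaluation at the images. On the right only complex power series remain.
\<close>

lemma hat_Phi:
  fixes \<psi> :: "'i::finite Y0 \<Rightarrow> complex"
  assumes "Y0_character \<psi>" "hbar \<noteq> 0"
  shows "fps_map \<psi> (Phi hbar d x) = U0_eval q_series
     (\<lambda>i. fps_exp (\<psi> (Y0_xi i 0) / 2)) (\<lambda>i. fps_exp (- \<psi> (Y0_xi i 0) / 2))
     (Y0_character.h_value \<psi> hbar d) x"
proof -
  interpret Y0_character \<psi> by fact
  show ?thesis
    unfolding Phi_def ring_morphism_U0_eval_apply[OF hat.ring_morphism_axioms]
    by (simp add: laurent_to_series_eq hat_emb hat_exp_v mult scalar Let_def hat.mult
        hat_borel_series[OF assms(2)] h_value_def[abs_def])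
qed

section \<open>Injectivity of $\Phi$\<close>

text \<open>
  Convergence and value are kept together so that the value of a polynomial expression in
  convergent series can be assembled along its structure.
\<close>

definition fps_converges :: "complex fps \<Rightarrow> complex \<Rightarrow> complex \<Rightarrow> bool" where
  "fps_converges F z w \<longleftrightarrow> ereal (norm z) < fps_conv_radius F \<and> eval_fps F z = w"

lemma fps_converges_add:
  "fps_converges F z w \<Longrightarrow> fps_converges G z u \<Longrightarrow> fps_converges (F + G) z (w + u)"
  by (auto simp: fps_converges_def eval_fps_add intro!: less_le_trans[OF _ fps_conv_radius_add])

lemma fps_converges_mult:
  "fps_converges F z w \<Longrightarrow> fps_converges G z u \<Longrightarrow> fps_converges (F * G) z (w * u)"
  by (auto simp: fps_converges_def eval_fps_mult intro!: less_le_trans[OF _ fps_conv_radius_mult])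

lemma fps_converges_diff:
  "fps_converges F z w \<Longrightarrow> fps_converges G z u \<Longrightarrow> fps_converges (F - G) z (w - u)"
  by (auto simp: fps_converges_def eval_fps_diff intro!: less_le_trans[OF _ fps_conv_radius_diff])

lemma fps_converges_const: "fps_converges (fps_const c) z c"
  by (simp add: fps_converges_def)

lemma fps_converges_exp: "fps_converges (fps_exp c) z (exp (c * z))"
  by (simp add: fps_converges_def)

lemma fps_converges_0: "fps_converges 0 z 0"
  by (simp add: fps_converges_def)

lemma fps_converges_1: "fps_converges 1 z 1"
  by (simp add: fps_converges_def)

lemma fps_converges_power: "fps_converges F z w \<Longrightarrow> fps_converges (F ^ n) z (w ^ n)"
  by (induction n) (simp_all add: fps_converges_1 fps_converges_mult)

lemma fps_converges_sum:
  "(\<And>x. x \<in> A \<Longrightarrow> fps_converges (F x) z (w x)) \<Longrightarrow> fps_converges (sum F A) z (sum w A)"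
  by (induction A rule: infinite_finite_induct) (simp_all add: fps_converges_0 fps_converges_add)

lemma fps_converges_prod:
  "(\<And>x. x \<in> A \<Longrightarrow> fps_converges (F x) z (w x)) \<Longrightarrow> fps_converges (prod F A) z (prod w A)"
  by (induction A rule: infinite_finite_induct) (simp_all add: fps_converges_1 fps_converges_mult)

lemma fps_converges_unique: "fps_converges F z w \<Longrightarrow> fps_converges F z u \<Longrightarrow> w = u"
  by (simp add: fps_converges_def)

lemma fps_converges_q_series: "fps_converges (q_series c) z (eval_fps (q_series c) z)"
proof -
  have "fps_converges (q_series c) z
      (\<Sum>n\<in>Poly_Mapping.keys c. Poly_Mapping.lookup c n * exp (of_int n / 2 * z))"
    unfolding q_series_def monoid_eval_def
    by (intro fps_converges_sum fps_converges_mult fps_converges_const fps_converges_exp)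
  then show ?thesis by (simp add: fps_converges_def)
qed

lemma eventually_fps_converges:
  assumes "fps_conv_radius F > 0"
  shows "eventually (\<lambda>z. \<exists>w. fps_converges F z w) (at 0)"
proof -
  have "eventually (\<lambda>z. z \<in> eball 0 (fps_conv_radius F)) (nhds 0)"
    using assms by (intro eventually_nhds_in_open) (auto simp: zero_ereal_def)
  then show ?thesis
    unfolding eventually_at_filter by eventually_elim (auto simp: fps_converges_def[abs_def])
qed

text \<open>
  After division by the leading power of the variable, the value at 0 is nonzero and continuity
  applies.
\<close>

lemma eventually_eval_fps_nonzero:
  fixes F :: "complex fps"
  assumes F: "F \<noteq> 0" and radius: "fps_conv_radius F > 0"
  shows "eventually (\<lambda>z. eval_fps F z \<noteq> 0) (at 0)"
proof -
  let ?n = "subdegree F"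
  let ?G = "fps_shift ?n F"
  have "isCont (eval_fps ?G) 0"
    using radius by (intro continuous_eval_fps) (simp add: zero_ereal_def)
  moreover have "eval_fps ?G 0 \<noteq> 0"
    using F by (simp add: eval_fps_at_0 nth_subdegree_nonzero)
  ultimately have G: "eventually (\<lambda>z. eval_fps ?G z \<noteq> 0) (at 0)"
    unfolding isCont_def by (rule tendsto_imp_eventually_ne)
  show ?thesis
    using G eventually_fps_converges[OF radius] eventually_neq_at_within[of 0 0 UNIV]
    by eventually_elim (auto simp: eval_fps_shift fps_converges_def[abs_def])
qed

text \<open>
  Numerator and denominator both vanish to first order at 0, so the quotient is a power series,
  and it converges near 0 as the inverse of a convergent series with nonzero constant term.
\<close>

lemma quantum_unit:
  assumes "s \<noteq> 0"
  shows "fps_X / (fps_exp s - fps_exp (- s)) * (fps_exp s - fps_exp (- s)) = (fps_X :: complex fps)"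
    and "fps_conv_radius (fps_X / (fps_exp s - fps_exp (- s :: complex))) > 0"
proof -
  let ?E = "fps_exp s - fps_exp (- s)"
  have deg: "subdegree ?E = 1"
    using assms by (intro subdegreeI) auto
  have E: "?E \<noteq> 0"
    using deg by auto
  then have "?E dvd fps_X"
    using deg by (subst fps_dvd_iff) auto
  then show *: "fps_X / ?E * ?E = fps_X"
    by simp
  let ?V = "inverse (fps_shift 1 ?E)"
  have "?E = fps_shift 1 ?E * fps_X"
    using fps_shift_times_fps_X_power[of 1 ?E] deg by simp
  then have "?V * ?E = (?V * fps_shift 1 ?E) * fps_X"
    by (metis mult.assoc)
  also have "?V * fps_shift 1 ?E = 1"
    using assms by (intro inverse_mult_eq_1) simp
  finally have "fps_X / ?E = ?V"
    using * E by (metis mult_cancel_right mult_1)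
  moreover have "fps_conv_radius ?E > 0"
    using fps_conv_radius_diff[of "fps_exp s" "fps_exp (- s)"] by simp
  then have "fps_conv_radius ?V > 0"
    using assms by (intro fps_conv_radius_inverse_pos) simp_all
  ultimately show "fps_conv_radius (fps_X / ?E) > 0"
    by simp
qed

lemma polynomial_interpolation:
  fixes g :: "'s \<Rightarrow> 'a::field"
  assumes "finite S" "inj_on g S"
  shows "\<exists>p. \<forall>s\<in>S. poly p (g s) = f s"
  using assms
proof (induction S)
  case (insert t S)
  then obtain p where p: "\<forall>s\<in>S. poly p (g s) = f s" by auto
  \<comment> \<open>Adding a multiple of the polynomial vanishing on the old nodes corrects the value at the new one.\<close>
  let ?N = "\<Prod>s\<in>S. [:- g s, 1:]"
  have N: "poly ?N (g t) \<noteq> 0" "\<forall>s\<in>S. poly ?N (g s) = 0"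
    using insert.hyps insert.prems by (auto simp: poly_prod)
  let ?p = "p + [:(f t - poly p (g t)) / poly ?N (g t):] * ?N"
  have "\<forall>s\<in>insert t S. poly ?p (g s) = f s"
    using p N by auto
  then show ?case ..
qed simp

lemma Y0_character_monoid_eval: "Y0_character (monoid_eval (\<lambda>c. c) (exponent_eval \<rho>))"
proof -
  interpret ring_morphism "monoid_eval (\<lambda>c. c) (exponent_eval \<rho>) :: _ \<Rightarrow> complex"
    by (rule ring_morphism_monoid_eval) (simp_all add: ring_morphism_id exponent_eval_0 exponent_eval_add)
  show ?thesis
    by standard (simp add: Y0_scalar_def monoid_eval_single exponent_eval_0)
qed

text \<open>
  The reduction of identities over \<open>Y\<^sup>0\<close> to identities over $\mathbb C$.
\<close>

lemma Y0_series_eq_if_characters_eq: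
  assumes "\<And>\<psi>. Y0_character \<psi> \<Longrightarrow> fps_map \<psi> F = fps_map \<psi> G"
  shows "F = G"
proof (rule fps_ext)
  fix n
  show "fps_nth F n = fps_nth G n"
  proof (rule polynomial_eq_if_eval_eq)
    fix \<rho>
    show "monoid_eval (\<lambda>c. c) (exponent_eval \<rho>) (fps_nth F n)
        = monoid_eval (\<lambda>c. c) (exponent_eval \<rho>) (fps_nth G n)"
      using arg_cong[OF assms[OF Y0_character_monoid_eval], of "\<lambda>H. fps_nth H n"] by simp
  qed
qed

text \<open>
  The $\xi_{i,r}$ are free generators, so a character may send $\xi_i(u)$ to any series with
  constant term 1, in particular to the exponential of a given one.
\<close>

lemma Y0_character_with_log:
  assumes hbar: "hbar \<noteq> 0" and G: "\<And>i. fps_nth (G i) 0 = 0"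
  obtains \<psi> :: "'i Y0 \<Rightarrow> complex" where "Y0_character \<psi>"
    "\<And>i. fps_log (fps_map \<psi> (xi_series hbar i)) = G i"
proof -
  define \<rho> where "\<rho> = (\<lambda>(i, r). fps_nth (fps_compose (fps_exp 1) (G i)) (Suc r) / hbar)"
  let ?\<psi> = "monoid_eval (\<lambda>c. c) (exponent_eval \<rho>) :: 'i Y0 \<Rightarrow> complex"
  interpret Y0_character ?\<psi> by (rule Y0_character_monoid_eval)
  have xi: "?\<psi> (Y0_xi i r) = \<rho> (i, r)" for i r
    by (simp add: Y0_xi_def monoid_eval_single exponent_eval_single del: One_nat_def)
  have "fps_map ?\<psi> (xi_series hbar i) = fps_compose (fps_exp 1) (G i)" for i
  proof (rule fps_ext)
    fix n
    show "fps_nth (fps_map ?\<psi> (xi_series hbar i)) n = fps_nth (fps_compose (fps_exp 1) (G i)) n"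
    proof (cases n)
      case 0
      then show ?thesis
        using hat_xi_series_nth_0[of hbar i] by simp
    next
      case (Suc r)
      then have "fps_nth (fps_map ?\<psi> (xi_series hbar i)) n = hbar * \<rho> (i, r)"
        by (simp add: xi_series_def add zero mult scalar xi)
      then show ?thesis
        using hbar by (simp add: Suc \<rho>_def)
    qed
  qed
  then show ?thesis
    using that[OF Y0_character_axioms] G by (simp add: fps_log_exp)
qed

lemma signed_power_two_inject:
  assumes "signed_power 2 (inverse 2 :: complex) m = signed_power 2 (inverse 2) n"
  shows "m = n"
proof -
  have "m \<ge> n" if "signed_power 2 (inverse 2 :: complex) m = signed_power 2 (inverse 2) n" for m n
  proof (rule ccontr)
    assume "\<not> m \<ge> n"
    define k where "k = nat (n - m)"
    have k: "n = m + int k" "k > 0"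
      using \<open>\<not> m \<ge> n\<close> by (simp_all add: k_def)
    have "signed_power 2 (inverse 2 :: complex) m * 1
        = signed_power 2 (inverse 2) m * signed_power 2 (inverse 2) (int k)"
      using that by (simp add: k(1) signed_power_add)
    moreover have "signed_power 2 (inverse 2 :: complex) m \<noteq> 0"
      by (simp add: signed_power_def)
    ultimately have "(2 :: complex) ^ k = 1"
      by (simp add: signed_power_def)
    then have "(2 :: nat) ^ k = 1"
      using of_nat_eq_iff[of "2 ^ k" 1, where ?'a = complex] by simp
    then show False
      using k(2) by simp
  qed
  from this[OF assms] this[OF assms[symmetric]] show ?thesis by simp
qed

lemma exponent_eval_one: "exponent_eval (\<lambda>_. 1) m = 1"
  by (simp add: exponent_eval_def)

lemma signed_power_one: "signed_power 1 1 n = 1"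
  by (simp add: signed_power_def)

text \<open>
  The points considered have nonzero coordinates for the $K_i$, as required by negative exponents.
\<close>

lemma U0_mon_eval_separates:
  fixes m n :: "'i::finite U0_mon"
  assumes "m \<noteq> n"
  obtains k :: "'i \<Rightarrow> complex" and h :: "'i \<Rightarrow> nzint \<Rightarrow> complex" where "\<And>i. k i \<noteq> 0"
    "U0_mon_eval k (\<lambda>i. inverse (k i)) h m \<noteq> U0_mon_eval k (\<lambda>i. inverse (k i)) h n"
proof (cases "fst m = fst n")
  case True
  with assms have "snd m \<noteq> snd n"
    by (simp add: prod_eq_iff)
  then obtain h :: "'i \<times> nzint \<Rightarrow> complex" where "exponent_eval h (snd m) \<noteq> exponent_eval h (snd n)"
    by (rule exponent_eval_separates)
  then show ?thesis
    by (intro that[of "\<lambda>_. 1" "\<lambda>i r. h (i, r)"]) (simp_all add: U0_mon_eval_def signed_power_one)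
next
  case False
  have "\<exists>i. Poly_Mapping.lookup (fst m) i \<noteq> Poly_Mapping.lookup (fst n) i"
    by (rule ccontr) (use poly_mapping_eqI[of "fst m" "fst n"] False in simp)
  then obtain i where i: "Poly_Mapping.lookup (fst m) i \<noteq> Poly_Mapping.lookup (fst n) i" ..
  let ?k = "\<lambda>l. if l = i then 2 else 1 :: complex"
  have "U0_mon_eval ?k (\<lambda>l. inverse (?k l)) (\<lambda>_ _. 1) m
      = signed_power 2 (inverse 2) (Poly_Mapping.lookup (fst m) i)" for m :: "'i U0_mon"
    by (simp add: U0_mon_eval_def case_prod_unfold exponent_eval_one prod_one_point[of i]
        signed_power_one)
  then show ?thesis
    using i signed_power_two_inject by (intro that[of ?k "\<lambda>_ _. 1"]) auto
qed

text \<open>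
  Points multiply coordinatewise, and evaluation of a monomial is a character of this monoid.
\<close>

lemma U0_point_nonvanishing:
  fixes S :: "'i::finite U0_mon set"
  assumes "finite S" "m \<in> S" "c m \<noteq> 0"
  obtains k :: "'i \<Rightarrow> complex" and h :: "'i \<Rightarrow> nzint \<Rightarrow> complex" where "\<And>i. k i \<noteq> 0"
    "(\<Sum>m\<in>S. c m * U0_mon_eval k (\<lambda>i. inverse (k i)) h m) \<noteq> 0"
proof -
  let ?P = "{(k :: 'i \<Rightarrow> complex, h :: 'i \<Rightarrow> nzint \<Rightarrow> complex). \<forall>i. k i \<noteq> 0}"
  let ?ev = "\<lambda>(m :: 'i U0_mon) (k :: 'i \<Rightarrow> complex, h). U0_mon_eval k (\<lambda>i. inverse (k i)) h m"
  have "\<exists>p\<in>?P. (\<Sum>m\<in>S. c m * ?ev m p) \<noteq> 0"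
  proof (rule ccontr)
    assume "\<not> ?thesis"
    then have vanish: "(\<Sum>m\<in>S. c m * ?ev m p) = 0" if "p \<in> ?P" for p
      using that by blast
    have "c m = 0"
    proof (rule independence_of_characters[where P = ?P and S = S and \<psi> = ?ev
          and e = "(\<lambda>_. 1, \<lambda>_ _. 1)"
          and opn = "\<lambda>(k, h) (l, g). (\<lambda>i. k i * l i, \<lambda>i r. h i r * g i r)"])
      show "?ev m (\<lambda>_. 1, \<lambda>_ _. 1) = 1" for m
        by (simp add: U0_mon_eval_def case_prod_unfold exponent_eval_one signed_power_one)
      show "?ev m ((\<lambda>(k, h) (l, g). (\<lambda>i. k i * l i, \<lambda>i r. h i r * g i r)) p q) = ?ev m p * ?ev m q"
        for m p q
        by (simp add: U0_mon_eval_def case_prod_unfold exponent_eval_mult signed_power_mult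
            prod.distrib mult_ac)
      show "\<exists>p\<in>?P. ?ev m p \<noteq> ?ev n p" if "m \<noteq> n" for m n :: "'i U0_mon"
        by (rule U0_mon_eval_separates[OF that]) auto
    qed (use assms vanish in auto)
    with assms show False by simp
  qed
  then show ?thesis
    using that by auto
qed

text \<open>
  The point of convergence \<open>z\<close> is chosen before the values of the generators, and
  these before the character: the coefficients of \<open>x\<close> at \<open>q = exp (z/2)\<close>
  determine suitable values, and \<open>z\<close> enters the nodes at which the polynomials
  realising them are interpolated.
\<close>

theorem Phi_eq_0_iff:
  fixes x :: "'i::finite U0"
  assumes hbar: "hbar \<noteq> 0" and d: "\<And>i. d i > 0"
  shows "Phi hbar d x = 0 \<longleftrightarrow> x = 0"
proof
  assume Phi0: "Phi hbar d x = 0"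
  show "x = 0"
  proof (rule ccontr)
    assume "x \<noteq> 0"
    let ?S = "Poly_Mapping.keys x"
    have "?S \<noteq> {}"
      using sum_singles[of x] \<open>x \<noteq> 0\<close> by auto
    then obtain m\<^sub>0 where m\<^sub>0: "m\<^sub>0 \<in> ?S" by blast
    let ?c = "\<lambda>m. q_series (Poly_Mapping.lookup x m)"
    define V where "V = (\<Union>m\<in>?S. Poly_Mapping.keys (snd m))"
    have V: "finite V" by (simp add: V_def)
    define s where "s = (\<lambda>(i, r). complex_of_int (int (d i) * int_of_nzint r) / 2)"
    have s: "s g \<noteq> 0" for g
      using d[of "fst g"] int_of_nzint[of "snd g"] by (simp add: s_def case_prod_unfold)
    define u where "u = (\<lambda>g. fps_X / (fps_exp (s g) - fps_exp (- s g)))"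
    have u_radius: "fps_conv_radius (u g) > 0" and u_mult: "u g * (fps_exp (s g) - fps_exp (- s g)) = fps_X" for g
      using quantum_unit[OF s] by (simp_all add: u_def)
    have "?c m\<^sub>0 \<noteq> 0"
      using m\<^sub>0 q_series_inject_zero[of "Poly_Mapping.lookup x m\<^sub>0"] by (auto simp: in_keys_iff)
    moreover have "fps_conv_radius (?c m\<^sub>0) > 0"
      using fps_converges_q_series[of "Poly_Mapping.lookup x m\<^sub>0" 0]
      by (simp add: fps_converges_def zero_ereal_def)
    ultimately have "eventually (\<lambda>z. eval_fps (?c m\<^sub>0) z \<noteq> 0) (at 0)"
      by (rule eventually_eval_fps_nonzero)
    moreover have "eventually (\<lambda>z. \<forall>g\<in>V. \<exists>w. fps_converges (u g) z w) (at 0)"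
      using V eventually_fps_converges[OF u_radius] by (simp add: eventually_ball_finite)
    moreover have "eventually (\<lambda>z :: complex. z \<noteq> 0) (at 0)"
      by (rule eventually_neq_at_within)
    ultimately have "eventually (\<lambda>z. eval_fps (?c m\<^sub>0) z \<noteq> 0 \<and> (\<forall>g\<in>V. \<exists>w. fps_converges (u g) z w) \<and> z \<noteq> 0) (at 0)"
      by (intro eventually_conj)
    then obtain z where z: "eval_fps (?c m\<^sub>0) z \<noteq> 0" "\<forall>g\<in>V. \<exists>w. fps_converges (u g) z w" "z \<noteq> 0"
      using eventually_happens'[OF at_neq_bot] by blast
    from z(2) obtain w where w: "\<And>g. g \<in> V \<Longrightarrow> fps_converges (u g) z (w g)"
      by metis
    \<comment> \<open>The values \<open>w g\<close> will be divided by; they are factors of \<open>z\<close>.\<close>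
    have w_nonzero: "w g \<noteq> 0" if "g \<in> V" for g
    proof -
      have "fps_converges (fps_exp (s g) - fps_exp (- s g)) z (exp (s g * z) - exp (- s g * z))"
        by (rule fps_converges_diff) (rule fps_converges_exp)+
      from fps_converges_mult[OF w[OF that] this]
      have "fps_converges fps_X z (w g * (exp (s g * z) - exp (- s g * z)))"
        by (simp add: u_mult)
      then show ?thesis
        using z(3) by (auto simp: fps_converges_def)
    qed

    obtain k and h :: "'i \<Rightarrow> nzint \<Rightarrow> complex" where k: "\<And>i. k i \<noteq> 0"
      and kh: "(\<Sum>m\<in>?S. eval_fps (?c m) z * U0_mon_eval k (\<lambda>i. inverse (k i)) h m) \<noteq> 0"
      using U0_point_nonvanishing[of ?S m\<^sub>0 "\<lambda>m. eval_fps (?c m) z"] m\<^sub>0 z(1) finite_keys by blast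

    \<comment> \<open>The nodes are the multiples of \<open>z / hbar\<close> by \<open>R\<close>; the node 0 is for the \<open>K\<^sub>i\<close>, and
      no other node vanishes because the indices \<open>r\<close> are nonzero. The value prescribed at 0
      inverts \<open>k i = exp (z * poly p 0 / (2 * hbar))\<close>.\<close>
    define R where "R = insert 0 ((\<lambda>g. int_of_nzint (snd g)) ` V)"
    have "\<exists>p. poly p 0 = 2 * hbar * Ln (k i) / z \<and>
        (\<forall>r. (i, r) \<in> V \<longrightarrow> poly p (of_int (int_of_nzint r) / hbar * z) = h i r / w (i, r))" for i
    proof -
      let ?f = "\<lambda>n. if n = 0 then 2 * hbar * Ln (k i) / z
        else h i (nzint_of_int n) / w (i, nzint_of_int n)"
      have "inj_on (\<lambda>n. of_int n / hbar * z) R"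
        using hbar z(3) by (simp add: inj_on_def)
      moreover have "finite R"
        using V by (simp add: R_def)
      ultimately obtain p where p: "\<forall>n\<in>R. poly p (of_int n / hbar * z) = ?f n"
        using polynomial_interpolation[of R "\<lambda>n. of_int n / hbar * z" ?f] by blast
      have "poly p 0 = 2 * hbar * Ln (k i) / z"
        using p by (simp add: R_def)
      moreover have "poly p (of_int (int_of_nzint r) / hbar * z) = h i r / w (i, r)" if "(i, r) \<in> V" for r
      proof -
        have "int_of_nzint r \<in> R"
          using that by (force simp: R_def)
        with p have "poly p (of_int (int_of_nzint r) / hbar * z) = ?f (int_of_nzint r)"
          by blast
        then show ?thesis
          using int_of_nzint[of r] by (simp add: int_of_nzint_inverse)
      qed
      ultimately show ?thesis by blast
    qed
    then obtain p where p0: "\<And>i. poly (p i) 0 = 2 * hbar * Ln (k i) / z"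
      and p: "\<And>i r. (i, r) \<in> V \<Longrightarrow> poly (p i) (of_int (int_of_nzint r) / hbar * z) = h i r / w (i, r)"
      by metis

    \<comment> \<open>The inverse Borel transform of \<open>p i\<close>, whose coefficient at $z^n$ moves to $u^{-n-1}$.\<close>
    define G where "G i = Abs_fps (\<lambda>n. if n = 0 then 0 else fact (n - 1) * coeff (p i) (n - 1))" for i
    have "fps_nth (G i) 0 = 0" for i
      by (simp add: G_def)
    then obtain \<psi> where char: "Y0_character \<psi>"
      and log: "\<And>i. fps_log (fps_map \<psi> (xi_series hbar i)) = G i"
      using Y0_character_with_log[OF hbar, of G] by blast
    interpret Y0_character \<psi> by fact
    have borel_p: "fps_converges (borel_transform c (G i)) z (poly (p i) (c * z))" for c i
    proof -
      have "borel_transform c (G i) = fps_of_poly (p i \<circ>\<^sub>p [:0, c:])"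
        by (rule fps_ext) (simp add: borel_transform_def G_def coeff_pcompose_linear)
      then show ?thesis
        by (simp add: fps_converges_def poly_pcompose mult.commute)
    qed
    have K: "fps_converges (fps_exp (\<psi> (Y0_xi i 0) / 2)) z (k i)"
      "fps_converges (fps_exp (- \<psi> (Y0_xi i 0) / 2)) z (inverse (k i))" for i
    proof -
      have "\<psi> (Y0_xi i 0) / 2 * z = Ln (k i)"
        using p0[of i] hbar z(3) by (simp add: xi_0[OF hbar] log G_def poly_0_coeff_0)
      then have "exp (\<psi> (Y0_xi i 0) / 2 * z) = k i" "exp (- \<psi> (Y0_xi i 0) / 2 * z) = inverse (k i)"
        using k[of i] exp_minus[of "\<psi> (Y0_xi i 0) / 2 * z"] by simp_all
      then show "fps_converges (fps_exp (\<psi> (Y0_xi i 0) / 2)) z (k i)"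
        "fps_converges (fps_exp (- \<psi> (Y0_xi i 0) / 2)) z (inverse (k i))"
        using fps_converges_exp[of "\<psi> (Y0_xi i 0) / 2" z] fps_converges_exp[of "- \<psi> (Y0_xi i 0) / 2" z]
        by simp_all
    qed
    have H: "fps_converges (h_value hbar d i r) z (h i r)" if "(i, r) \<in> V" for i r
    proof -
      have "fps_converges (u (i, r) * borel_transform (of_int (int_of_nzint r) / hbar) (G i)) z
          (w (i, r) * (h i r / w (i, r)))"
        using fps_converges_mult[OF w[OF that] borel_p] p[OF that] by metis
      then show ?thesis
        using w_nonzero[OF that] by (simp add: h_value_def log u_def s_def Let_def)
    qed
    let ?K = "\<lambda>i. fps_exp (\<psi> (Y0_xi i 0) / 2)" and ?K' = "\<lambda>i. fps_exp (- \<psi> (Y0_xi i 0) / 2)"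
    have mon: "fps_converges (U0_mon_eval ?K ?K' (h_value hbar d) m) z
        (U0_mon_eval k (\<lambda>i. inverse (k i)) h m)" if "m \<in> ?S" for m
      unfolding U0_mon_eval_def
    proof (rule fps_converges_mult)
      show "fps_converges (\<Prod>i\<in>UNIV. signed_power (?K i) (?K' i) (Poly_Mapping.lookup (fst m) i)) z
          (\<Prod>i\<in>UNIV. signed_power (k i) (inverse (k i)) (Poly_Mapping.lookup (fst m) i))"
        unfolding signed_power_def using K by (auto intro!: fps_converges_prod fps_converges_power)
      have "Poly_Mapping.keys (snd m) \<subseteq> V"
        using that by (auto simp: V_def)
      then show "fps_converges (exponent_eval (case_prod (h_value hbar d)) (snd m)) z
          (exponent_eval (case_prod h) (snd m))"
        unfolding exponent_eval_def using H by (auto intro!: fps_converges_prod fps_converges_power)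
    qed
    have "fps_converges (fps_map \<psi> (Phi hbar d x)) z
        (\<Sum>m\<in>?S. eval_fps (?c m) z * U0_mon_eval k (\<lambda>i. inverse (k i)) h m)"
      unfolding hat_Phi[OF char hbar] U0_eval_eq_monoid_eval monoid_eval_def
      by (intro fps_converges_sum fps_converges_mult fps_converges_q_series mon)
    moreover have "fps_map \<psi> (Phi hbar d x) = 0"
      by (simp add: Phi0 hat.zero)
    ultimately have "fps_converges 0 z
        (\<Sum>m\<in>?S. eval_fps (?c m) z * U0_mon_eval k (\<lambda>i. inverse (k i)) h m)"
      by (simp only:)
    from fps_converges_unique[OF this fps_converges_0] kh show False by contradiction
  qed
next
  assume "x = 0"
  then show "Phi hbar d x = 0"
    by (simp add: Phi_def U0_eval_def)
qed

lemma Y0_emb_eq: "Y0_emb = fps_map Y0_scalar"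
  by (simp add: fun_eq_iff Y0_emb_def fps_map_def)

lemma ring_morphism_laurent_to_series: "ring_morphism laurent_to_series"
  unfolding laurent_to_series_eq[abs_def] Y0_emb_eq
  by (rule ring_morphism_comp[OF ring_morphism_q_series ring_morphism_fps_map[OF ring_morphism_Y0_scalar]])

theorem inj_Phi:
  fixes d :: "'i::finite \<Rightarrow> nat"
  assumes "hbar \<noteq> 0" "\<And>i. d i > 0"
  shows "inj (Phi hbar d)"
proof (rule injI)
  fix x y :: "'i U0"
  assume "Phi hbar d x = Phi hbar d y"
  moreover have "Phi hbar d (x - y + y) = Phi hbar d (x - y) + Phi hbar d y"
    unfolding Phi_def U0_eval_eq_monoid_eval by (rule monoid_eval_add[OF ring_morphism_laurent_to_series])
  ultimately have "Phi hbar d (x - y) = 0" by simp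
  then show "x = y"
    using Phi_eq_0_iff[where d = d, OF assms] by simp
qed

section \<open>Tensor squares and the Hopf structure\<close>

text \<open>
  The embeddings \<open>x \<mapsto> x \<otimes> 1\<close> and \<open>y \<mapsto> 1 \<otimes>
  y\<close>. Being ring homomorphisms, they reduce computations with tensors to computations in a
  commutative ring.
\<close>

definition tensor_left :: "'i U0 \<Rightarrow> 'i U0_tensor" where
  "tensor_left = monoid_eval U0_tensor_scalar (\<lambda>m. Poly_Mapping.single (m, 0) 1)"

definition tensor_right :: "'i U0 \<Rightarrow> 'i U0_tensor" where
  "tensor_right = monoid_eval U0_tensor_scalar (\<lambda>m. Poly_Mapping.single (0, m) 1)"

lemma ring_morphism_tensor_scalar: "ring_morphism U0_tensor_scalar"
  by standard (simp_all add: U0_tensor_scalar_def mult_single single_add)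

lemma tensor_scalar_0: "U0_tensor_scalar 0 = 0"
  by (simp add: U0_tensor_scalar_def)

lemma ring_morphism_tensor_left: "ring_morphism tensor_left"
  unfolding tensor_left_def
  by (rule ring_morphism_monoid_eval[OF ring_morphism_tensor_scalar])
     (simp_all add: mult_single flip: single_one zero_prod_def)

lemma ring_morphism_tensor_right: "ring_morphism tensor_right"
  unfolding tensor_right_def
  by (rule ring_morphism_monoid_eval[OF ring_morphism_tensor_scalar])
     (simp_all add: mult_single flip: single_one zero_prod_def)

interpretation left: ring_morphism tensor_left by (rule ring_morphism_tensor_left)
interpretation right: ring_morphism tensor_right by (rule ring_morphism_tensor_right)

lemma tensor_left_scalar: "tensor_left (U0_scalar c) = U0_tensor_scalar c"
  by (simp add: tensor_left_def U0_scalar_def monoid_eval_single tensor_scalar_0 flip: zero_prod_def)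

lemma tensor_right_scalar: "tensor_right (U0_scalar c) = U0_tensor_scalar c"
  by (simp add: tensor_right_def U0_scalar_def monoid_eval_single tensor_scalar_0 flip: zero_prod_def)

lemma U0_otimes_eq: "U0_otimes x y = tensor_left x * tensor_right y"
  by (simp add: U0_otimes_def tensor_left_def tensor_right_def monoid_eval_def sum_product
      U0_tensor_scalar_def mult_single)

lemma single_eq_scalar_mult: "Poly_Mapping.single m c = U0_scalar c * Poly_Mapping.single m 1"
  by (simp add: U0_scalar_def mult_single)

lemma U0_algebra_hom_iff:
  "U0_algebra_hom T \<longleftrightarrow> ring_morphism T \<and> (\<forall>c. T (U0_scalar c) = U0_scalar c)"
proof
  assume T: "U0_algebra_hom T"
  then have "ring_morphism T"
    by (simp add: U0_algebra_hom_def ring_morphism_def)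
  moreover have "T (U0_scalar c * 1) = U0_scalar c" for c
    using T unfolding U0_algebra_hom_def by (metis mult.right_neutral)
  ultimately show "ring_morphism T \<and> (\<forall>c. T (U0_scalar c) = U0_scalar c)"
    by simp
qed (simp add: U0_algebra_hom_def ring_morphism_def)

locale U0_endomorphism = ring_morphism T for T :: "'i::finite U0 \<Rightarrow> 'i U0" +
  assumes scalar: "T (U0_scalar c) = U0_scalar c"
begin

lemma tensor_map_eq: "U0_tensor_map T = monoid_eval U0_tensor_scalar
    (\<lambda>(m, n). tensor_left (T (Poly_Mapping.single m 1)) * tensor_right (T (Poly_Mapping.single n 1)))"
  by (simp add: fun_eq_iff U0_tensor_map_def monoid_eval_def U0_otimes_eq case_prod_unfold)

lemma T_single_add:
  "T (Poly_Mapping.single (m + n) 1) = T (Poly_Mapping.single m 1) * T (Poly_Mapping.single n 1)"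
  by (simp add: mult_single flip: mult)

sublocale tensor: ring_morphism "U0_tensor_map T"
  unfolding tensor_map_eq
  by (rule ring_morphism_monoid_eval[OF ring_morphism_tensor_scalar])
     (simp_all add: one left.one right.one case_prod_unfold T_single_add left.mult right.mult mult_ac)

lemma tensor_map_scalar: "U0_tensor_map T (U0_tensor_scalar c) = U0_tensor_scalar c"
  by (simp add: tensor_map_eq U0_tensor_scalar_def[of c] monoid_eval_single tensor_scalar_0
      case_prod_unfold one left.one right.one)

lemma tensor_map_left: "U0_tensor_map T (tensor_left x) = tensor_left (T x)"
proof (rule additive_ext[where x = x])
  show "U0_tensor_map T (tensor_left (Poly_Mapping.single m c)) = tensor_left (T (Poly_Mapping.single m c))"
    for m c
  proof -
    have "U0_tensor_map T (tensor_left (Poly_Mapping.single m 1)) = tensor_left (T (Poly_Mapping.single m 1))"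
      by (simp add: tensor_left_def[THEN fun_cong, of "Poly_Mapping.single m 1"] monoid_eval_single tensor_scalar_0
          ring_morphism.one[OF ring_morphism_tensor_scalar] tensor_map_eq case_prod_unfold one right.one)
    then show ?thesis
      by (subst (1 2) single_eq_scalar_mult)
         (simp add: mult left.mult tensor.mult scalar tensor_left_scalar tensor_map_scalar)
  qed
qed (simp_all add: add left.add tensor.add)

lemma tensor_map_right: "U0_tensor_map T (tensor_right x) = tensor_right (T x)"
proof (rule additive_ext[where x = x])
  show "U0_tensor_map T (tensor_right (Poly_Mapping.single m c)) = tensor_right (T (Poly_Mapping.single m c))"
    for m c
  proof -
    have "U0_tensor_map T (tensor_right (Poly_Mapping.single m 1)) = tensor_right (T (Poly_Mapping.single m 1))"
      by (simp add: tensor_right_def[THEN fun_cong, of "Poly_Mapping.single m 1"] monoid_eval_single tensor_scalar_0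
          ring_morphism.one[OF ring_morphism_tensor_scalar] tensor_map_eq case_prod_unfold one left.one)
    then show ?thesis
      by (subst (1 2) single_eq_scalar_mult)
         (simp add: mult right.mult tensor.mult scalar tensor_right_scalar tensor_map_scalar)
  qed
qed (simp_all add: add right.add tensor.add)

end

lemma ring_morphism_signed_power:
  assumes "ring_morphism f"
  shows "f (signed_power k k' n) = signed_power (f k) (f k') n"
  by (simp add: signed_power_def ring_morphism.power[OF assms])

lemma otimes_K_inverse:
  "U0_otimes (U0_K i 1) (U0_K i 1) * U0_otimes (U0_K i (-1)) (U0_K i (-1)) = 1"
proof -
  have "tensor_left (U0_K i 1 * U0_K i (-1)) * tensor_right (U0_K i 1 * U0_K i (-1)) = 1"
    by (simp only: U0_K_inverse left.one right.one mult_1)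
  then show ?thesis
    by (simp add: U0_otimes_eq left.mult right.mult mult_ac)
qed

lemma ring_morphism_comult: "ring_morphism (U0_comult :: 'i::finite U0 \<Rightarrow> _)"
  unfolding U0_comult_def
  by (rule ring_morphism_U0_eval[OF ring_morphism_tensor_scalar otimes_K_inverse])

lemma comult_scalar: "U0_comult (U0_scalar c) = U0_tensor_scalar c"
  by (simp add: U0_comult_def U0_eval_scalar[OF ring_morphism_tensor_scalar])

lemma comult_K: "U0_comult (U0_K i n) = tensor_left (U0_K i n) * tensor_right (U0_K i n)"
  using ring_morphism_signed_power[OF ring_morphism_tensor_left, of "U0_K i 1" "U0_K i (-1)" n]
    ring_morphism_signed_power[OF ring_morphism_tensor_right, of "U0_K i 1" "U0_K i (-1)" n]
    signed_power_U0_K[of i 1 n]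
  by (simp add: U0_comult_def U0_eval_K[OF ring_morphism_tensor_scalar] U0_otimes_eq signed_power_mult)

lemma comult_h: "U0_comult (U0_h i r) = tensor_left (U0_h i r) + tensor_right (U0_h i r)"
  by (simp add: U0_comult_def U0_eval_h[OF ring_morphism_tensor_scalar] U0_otimes_eq left.one right.one)

lemma ring_morphism_counit: "ring_morphism (U0_counit :: 'i::finite U0 \<Rightarrow> _)"
  unfolding U0_counit_def by (rule ring_morphism_U0_eval[OF ring_morphism_id]) simp

lemma counit_K: "U0_counit (U0_K i n) = 1"
  by (simp add: U0_counit_def U0_eval_K[OF ring_morphism_id] signed_power_one)

lemma counit_h: "U0_counit (U0_h i r) = 0"
  by (simp add: U0_counit_def U0_eval_h[OF ring_morphism_id])

lemma counit_scalar: "U0_counit (U0_scalar c) = c"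
  by (simp add: U0_counit_def U0_eval_scalar[OF ring_morphism_id])

lemma ring_morphism_antipode: "ring_morphism (U0_antipode :: 'i::finite U0 \<Rightarrow> _)"
  unfolding U0_antipode_def
  by (rule ring_morphism_U0_eval[OF ring_morphism_U0_scalar]) (use U0_K_inverse[of _ "-1"] in simp)

lemma antipode_K: "U0_antipode (U0_K i n) = U0_K i (- n)"
  using signed_power_U0_K[of i "-1" n]
  by (simp add: U0_antipode_def U0_eval_K[OF ring_morphism_U0_scalar])

lemma antipode_h: "U0_antipode (U0_h i r) = - U0_h i r"
  by (simp add: U0_antipode_def U0_eval_h[OF ring_morphism_U0_scalar])

lemma antipode_scalar: "U0_antipode (U0_scalar c) = U0_scalar c"
  by (simp add: U0_antipode_def U0_eval_scalar[OF ring_morphism_U0_scalar])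

section \<open>Reflections as Hopf automorphisms\<close>

text \<open>
  The coefficients \<open>c\<close> are left arbitrary because the inverse of the operator has the
  same form with other coefficients.
\<close>

definition U0_reflection ::
    "('i::finite \<Rightarrow> 'i \<Rightarrow> int) \<Rightarrow> 'i \<Rightarrow> ('i \<Rightarrow> nzint \<Rightarrow> laurent) \<Rightarrow> 'i U0 \<Rightarrow> 'i U0" where
  "U0_reflection a j c = U0_eval U0_scalar
     (\<lambda>i. U0_K i 1 * U0_K j (- a j i)) (\<lambda>i. U0_K i (-1) * U0_K j (a j i))
     (\<lambda>i r. U0_h i r - U0_scalar (c i r) * U0_h j r)"

lemma reflection_inverse:
  "U0_K i 1 * U0_K j (- n) * (U0_K i (-1) * U0_K j n) = 1"
proof -
  have "U0_K i 1 * U0_K j (- n) * (U0_K i (-1) * U0_K j n)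
      = (U0_K i 1 * U0_K i (-1)) * (U0_K j n * U0_K j (- n))"
    by (simp add: mult_ac)
  then show ?thesis by (simp only: U0_K_inverse mult_1)
qed

lemma U0_endomorphism_reflection: "U0_endomorphism (U0_reflection a j c)"
proof -
  interpret ring_morphism "U0_reflection a j c"
    unfolding U0_reflection_def
    by (rule ring_morphism_U0_eval[OF ring_morphism_U0_scalar reflection_inverse])
  show ?thesis
    by standard (simp add: U0_reflection_def U0_eval_scalar[OF ring_morphism_U0_scalar])
qed

lemma reflection_K: "U0_reflection a j c (U0_K i n) = U0_K i n * U0_K j (- (a j i * n))"
  using signed_power_U0_K[of i 1 n] signed_power_U0_K[of j "- a j i" n]
  by (simp add: U0_reflection_def U0_eval_K[OF ring_morphism_U0_scalar] signed_power_mult)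

lemma reflection_h: "U0_reflection a j c (U0_h i r) = U0_h i r - U0_scalar (c i r) * U0_h j r"
  by (simp add: U0_reflection_def U0_eval_h[OF ring_morphism_U0_scalar])

text \<open>
  On \<open>h\<^sub>i\<^sub>,\<^sub>r\<close> the composite subtracts a multiple of
  \<open>h\<^sub>j\<^sub>,\<^sub>r\<close>, whose coefficient is the one assumed to vanish; on the
  \<open>K\<^sub>i\<close> the claim is that \<open>s\<^sub>j\<close> is an involution.
\<close>

lemma reflection_comp:
  assumes a: "a j j = 2" and c: "\<And>i r. c i r + c' i r * (1 - c j r) = 0"
  shows "U0_reflection a j c (U0_reflection a j c' x) = x"
proof -
  interpret R: U0_endomorphism "U0_reflection a j c" by (rule U0_endomorphism_reflection)
  interpret R': U0_endomorphism "U0_reflection a j c'" by (rule U0_endomorphism_reflection)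
  interpret s: ring_morphism U0_scalar by (rule ring_morphism_U0_scalar)
  show ?thesis
  proof (rule U0_hom_ext[where f = "\<lambda>x. U0_reflection a j c (U0_reflection a j c' x)" and x = x])
    show "ring_morphism (\<lambda>x. U0_reflection a j c (U0_reflection a j c' x))"
      by (rule ring_morphism_comp[OF R'.ring_morphism_axioms R.ring_morphism_axioms])
    show "U0_reflection a j c (U0_reflection a j c' (U0_K i 1)) = U0_K i 1" for i
      using U0_K_inverse[of j "a j i"] a
      by (simp add: reflection_K R.mult mult.assoc flip: U0_K_add)
    show "U0_reflection a j c (U0_reflection a j c' (U0_h i r)) = U0_h i r" for i r
    proof -
      have "U0_reflection a j c (U0_reflection a j c' (U0_h i r))
          = U0_h i r - U0_scalar (c i r + c' i r * (1 - c j r)) * U0_h j r"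
        by (simp add: reflection_h R.diff R.mult R.scalar s.add s.mult s.diff s.one algebra_simps)
      then show ?thesis
        by (simp add: c s.zero)
    qed
  qed (simp_all add: R.scalar R'.scalar ring_morphism_id)
qed

text \<open>
  All compatibilities are equalities of ring homomorphisms, checked on generators.
\<close>

lemma reflection_hopf:
  assumes bij: "bij (U0_reflection a j c)"
  shows "U0_hopf_automorphism (U0_reflection a j c)"
proof -
  let ?T = "U0_reflection a j c"
  interpret T: U0_endomorphism ?T by (rule U0_endomorphism_reflection)
  interpret comult: ring_morphism U0_comult by (rule ring_morphism_comult)
  interpret counit: ring_morphism U0_counit by (rule ring_morphism_counit)
  interpret antipode: ring_morphism U0_antipode by (rule ring_morphism_antipode)
  have "U0_comult (?T x) = U0_tensor_map ?T (U0_comult x)" for x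
    by (rule U0_hom_ext[where x = x])
       (auto simp: T.scalar comult_scalar T.tensor_map_scalar reflection_K comult_K comult.mult left.mult
          right.mult T.tensor.mult T.tensor.add T.tensor_map_left T.tensor_map_right mult_ac
          reflection_h comult_h comult.diff left.diff right.diff tensor_left_scalar tensor_right_scalar
          algebra_simps
        intro!: ring_morphism_comp[OF T.ring_morphism_axioms comult.ring_morphism_axioms]
          ring_morphism_comp[OF comult.ring_morphism_axioms T.tensor.ring_morphism_axioms])
  moreover have "U0_counit (?T x) = U0_counit x" for x
    by (rule U0_hom_ext[where x = x])
       (auto simp: T.scalar counit_scalar reflection_K counit_K counit.mult reflection_h counit_h counit.diff
        intro!: ring_morphism_comp[OF T.ring_morphism_axioms counit.ring_morphism_axioms] ring_morphism_counit)
  moreover have "U0_antipode (?T x) = ?T (U0_antipode x)" for x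
    by (rule U0_hom_ext[where x = x])
       (auto simp: T.scalar antipode_scalar reflection_K antipode_K antipode.mult reflection_h antipode_h
          antipode.diff T.uminus
        intro!: ring_morphism_comp[OF T.ring_morphism_axioms antipode.ring_morphism_axioms]
          ring_morphism_comp[OF antipode.ring_morphism_axioms T.ring_morphism_axioms])
  ultimately show ?thesis
    using bij T.scalar T.ring_morphism_axioms
    by (simp add: U0_hopf_automorphism_def U0_algebra_hom_iff fun_eq_iff)
qed

text \<open>
  The quotient of quantum integers in the formula for \<open>h\<^sub>i\<^sub>,\<^sub>r\<close>
  appears here as the single quantum integer given by \<open>exact_quot_qint\<close>.
\<close>

definition braid_coeff ::
    "('i::finite \<Rightarrow> 'i \<Rightarrow> int) \<Rightarrow> ('i \<Rightarrow> nat) \<Rightarrow> 'i \<Rightarrow> 'i \<Rightarrow> nzint \<Rightarrow> laurent" where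
  "braid_coeff a d j i r =
     qpow (int (d j) * int_of_nzint r) * qint (int (d i) * int_of_nzint r) (a i j)"

text \<open>
  The coefficient at \<open>i = j\<close> is $1 + q_j^{2r}$, so $h_{j,r}$ is multiplied by
  $-q_j^{2r}$. Multiplying all coefficients by $q_j^{-2r}$ gives the coefficients of the inverse.
\<close>

lemma bij_braid_reflection:
  assumes a: "a j j = 2" and d: "d j > 0"
  shows "bij (U0_reflection a j (braid_coeff a d j))"
proof -
  let ?c = "braid_coeff a d j"
  let ?u = "\<lambda>r. qpow (- (2 * (int (d j) * int_of_nzint r)))"
  have "int (d j) * int_of_nzint r \<noteq> 0" for r
    using d int_of_nzint[of r] by simp
  then have "qint (int (d j) * int_of_nzint r) 2
      = qpow (int (d j) * int_of_nzint r) + qpow (- (int (d j) * int_of_nzint r))" for r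
    by (rule qint_2)
  moreover have "qpow n * (qpow n + qpow (- n)) = qpow (2 * n) + 1" for n
    by (simp add: distrib_left qpow_0 flip: qpow_add)
  ultimately have "?c j r = qpow (2 * (int (d j) * int_of_nzint r)) + 1" for r
    by (simp only: braid_coeff_def a)
  then have u: "?u r * (1 - ?c j r) = - 1" for r
    by (simp flip: qpow_add add: qpow_0)
  have "?c i r + ?u r * ?c i r * (1 - ?c j r) = ?c i r * (1 + ?u r * (1 - ?c j r))" for i r
    by (simp add: algebra_simps)
  then have 1: "?c i r + ?u r * ?c i r * (1 - ?c j r) = 0" for i r
    by (simp only: u) simp
  have "?u r * ?c i r + ?c i r * (1 - ?u r * ?c j r) = ?c i r * (1 + ?u r * (1 - ?c j r))" for i r
    by (simp add: algebra_simps)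
  then have 2: "?u r * ?c i r + ?c i r * (1 - ?u r * ?c j r) = 0" for i r
    by (simp only: u) simp
  show ?thesis
    by (rule o_bij[where g = "U0_reflection a j (\<lambda>i r. ?u r * ?c i r)"])
       (simp_all add: fun_eq_iff reflection_comp[where a = a and j = j, OF a] 1 2)
qed

section \<open>The braid operator under characters\<close>

lemma (in Y0_character) Y0_character_braid: "Y0_character (\<lambda>p. \<psi> (Y0_braid hbar a d j p))"
proof -
  interpret B: ring_morphism "Y0_braid hbar a d j"
    unfolding Y0_braid_def by (rule ring_morphism_Y0_subst)
  interpret C: ring_morphism "\<lambda>p. \<psi> (Y0_braid hbar a d j p)"
    by (rule ring_morphism_comp[OF B.ring_morphism_axioms ring_morphism_axioms])
  show ?thesis
    by standard (simp add: Y0_braid_def Y0_subst_scalar scalar)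
qed

text \<open>
  The logarithm is additive and commutes with translations, so the product that defines the braid
  operator becomes a sum of translates of a single series.
\<close>

lemma (in Y0_character) log_braid:
  fixes hbar :: complex and a :: "'i \<Rightarrow> 'i \<Rightarrow> int" and d :: "'i \<Rightarrow> nat" and j :: 'i
  defines "L i \<equiv> fps_log (fps_map \<psi> (xi_series hbar i))"
    and "L' i \<equiv> fps_log (fps_map (\<lambda>p. \<psi> (Y0_braid hbar a d j p)) (xi_series hbar i))"
  assumes hbar: "hbar \<noteq> 0"
  shows "L' i = L i + (if i = j then - 1 else 1) * (\<Sum>k<nat \<bar>a j i\<bar>.
    fps_compose (L j) (translation (hbar * of_nat (d j) / 2 * (of_int \<bar>a j i\<bar> - 2 * of_nat k))))"
proof -
  define s where "s k = hbar * of_nat (d j) / 2 * (of_int \<bar>a j i\<bar> - 2 * of_nat k)" for k :: nat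
  let ?F = "\<lambda>k. shift_series (s k) (xi_series hbar j)"
  let ?G = "\<lambda>k. if i = j then fps_right_inverse (?F k) 1 else ?F k"
  have xi_0: "fps_nth (xi_series hbar l) 0 = 1" for l :: 'i
    by (simp add: xi_series_def)
  have F_0: "fps_nth (?F k) 0 = 1" for k
    by (simp add: shift_series_def xi_0)
  have hat_0: "fps_nth (fps_map \<psi> H) 0 = 1" if "fps_nth H 0 = 1" for H
    using that by (simp add: one)
  have G_0: "fps_nth (?G k) 0 = 1" for k
  proof (cases "i = j")
    case True
    then show ?thesis
      using fps_lr_inverse_nth_0(2)[of "?F k" 1] by (simp only: if_True simp_thms)
  qed (simp only: F_0 if_False)
  have log_F: "fps_log (fps_map \<psi> (?F k)) = fps_compose (L j) (translation (s k))" for k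
    by (simp add: hat_shift_series L_def fps_log_compose hat_xi_series_nth_0 del: fps_map_nth)
  have log_G: "fps_log (fps_map \<psi> (?G k))
      = (if i = j then - 1 else 1) * fps_compose (L j) (translation (s k))" for k
  proof (cases "i = j")
    case True
    have "?F k * fps_right_inverse (?F k) 1 = 1"
      by (rule fps_right_inverse) (simp only: F_0 mult_1)
    then have "fps_map \<psi> (?F k) * fps_map \<psi> (fps_right_inverse (?F k) 1) = 1"
      by (simp flip: hat.mult add: hat.one)
    then have "fps_log (fps_map \<psi> (fps_right_inverse (?F k) 1)) = - fps_log (fps_map \<psi> (?F k))"
      by (intro fps_log_inverse hat_0 F_0) simp_all
    then show ?thesis
      using True by (simp add: log_F)
  qed (simp add: log_F)
  have "fps_map (\<lambda>p. \<psi> (Y0_braid hbar a d j p)) (xi_series hbar i)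
      = fps_map \<psi> (Abs_fps (\<lambda>n. Y0_braid hbar a d j (fps_nth (xi_series hbar i) n)))"
    by (simp add: fps_map_def)
  also have "\<dots> = fps_map \<psi> (braid_xi_series hbar a d j i)"
    by (simp only: Y0_braid_xi_series[OF hbar])
  also have "\<dots> = fps_map \<psi> (xi_series hbar i) * (\<Prod>k<nat \<bar>a j i\<bar>. fps_map \<psi> (?G k))"
    unfolding braid_xi_series_def Let_def s_def hat.mult hat.prod ..
  finally have "L' i = L i + fps_log (\<Prod>k<nat \<bar>a j i\<bar>. fps_map \<psi> (?G k))"
    unfolding L_def L'_def
    by (simp only:) (intro fps_log_mult fps_prod_nth_0 hat_0 xi_0 G_0)
  also have "fps_log (\<Prod>k<nat \<bar>a j i\<bar>. fps_map \<psi> (?G k)) = (\<Sum>k<nat \<bar>a j i\<bar>. fps_log (fps_map \<psi> (?G k)))"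
    by (intro fps_log_prod hat_0 G_0)
  finally show ?thesis
    unfolding log_G unfolding s_def sum_distrib_left .
qed

text \<open>
  Here \<open>t\<close> is the exponent for which $e^t = q_j^r$ as a series in \<open>v\<close>.
  For \<open>i = j\<close> the sign is $-1$ and $|a_{jj}| = a_{jj}$; otherwise the sign is $+1$
  and $|a_{ji}| = -a_{ji}$. So the two cases give the same formula. The second identity is the
  constant coefficient of the transform at \<open>c = 0\<close>, where all the exponential factors
  equal 1.
\<close>

lemma (in Y0_character) borel_braid:
  fixes hbar :: complex and a :: "'i \<Rightarrow> 'i \<Rightarrow> int" and d :: "'i \<Rightarrow> nat" and j :: 'i and r :: int
  defines "L i \<equiv> fps_log (fps_map \<psi> (xi_series hbar i))"
    and "L' i \<equiv> fps_log (fps_map (\<lambda>p. \<psi> (Y0_braid hbar a d j p)) (xi_series hbar i))"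
    and "t \<equiv> of_int (int (d j) * r) / 2 :: complex"
  assumes hbar: "hbar \<noteq> 0" and a: "a j j = 2" "i \<noteq> j \<longrightarrow> a j i \<le> 0"
  shows "borel_transform (of_int r / hbar) (L' i) * (fps_exp t - fps_exp (- t))
    = borel_transform (of_int r / hbar) (L i) * (fps_exp t - fps_exp (- t))
      - fps_exp t * (fps_exp (of_int (a j i) * t) - fps_exp (- (of_int (a j i) * t)))
        * borel_transform (of_int r / hbar) (L j)"
    and "fps_nth (L' i) 1 = fps_nth (L i) 1 - of_int (a j i) * fps_nth (L j) 1"
proof -
  let ?c = "of_int r / hbar"
  let ?m = "nat \<bar>a j i\<bar>"
  let ?\<epsilon> = "if i = j then - 1 else 1 :: complex fps"
  let ?s = "\<lambda>k. hbar * of_nat (d j) / 2 * (of_int \<bar>a j i\<bar> - 2 * of_nat k)"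
  have \<epsilon>: "?\<epsilon> * F = (if i = j then - F else F)" for F
    by simp
  have borel_\<epsilon>: "borel_transform c (?\<epsilon> * F) = ?\<epsilon> * borel_transform c F" for c F
    by (simp add: borel_transform_uminus)
  have m: "of_int \<bar>a j i\<bar> = (of_nat ?m :: complex)"
    by simp
  have log: "L' i = L i + ?\<epsilon> * (\<Sum>k<?m. fps_compose (L j) (translation (?s k)))"
    unfolding L_def L'_def by (rule log_braid) (rule hbar)
  have shifted: "borel_transform c (L' i) = borel_transform c (L i) + ?\<epsilon> * (\<Sum>k<?m. fps_exp (c * ?s k)) * borel_transform c (L j)" for c
    unfolding log borel_transform_add borel_\<epsilon> borel_transform_sum borel_transform_translation sum_distrib_right mult.assoc ..
  have exponent: "?c * ?s k = t * (of_nat ?m - 2 * of_nat k)" for k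
    using hbar by (simp add: t_def mult_ac)
  have "(\<Sum>k<?m. fps_exp (?c * ?s k)) * (fps_exp t - fps_exp (- t))
      = fps_exp t * (fps_exp (of_nat ?m * t) - fps_exp (- (of_nat ?m * t)))"
    unfolding exponent by (rule fps_exp_geometric_sum)
  then have geometric: "?\<epsilon> * ((\<Sum>k<?m. fps_exp (?c * ?s k)) * (fps_exp t - fps_exp (- t)))
      = - (fps_exp t * (fps_exp (of_int (a j i) * t) - fps_exp (- (of_int (a j i) * t))))"
  proof (cases "i = j")
    case False
    then have "of_nat ?m = (- of_int (a j i) :: complex)"
      using a(2) by (simp flip: of_int_minus add: abs_if)
    with False show ?thesis
      using \<open>(\<Sum>k<?m. _) * _ = _\<close> by (simp add: algebra_simps)
  qed (use a(1) in simp)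
  have "?\<epsilon> * (\<Sum>k<?m. fps_exp (?c * ?s k)) * borel_transform ?c (L j) * (fps_exp t - fps_exp (- t))
      = ?\<epsilon> * ((\<Sum>k<?m. fps_exp (?c * ?s k)) * (fps_exp t - fps_exp (- t))) * borel_transform ?c (L j)"
    by (simp only: mult_ac)
  also have "\<dots> = - (fps_exp t * (fps_exp (of_int (a j i) * t) - fps_exp (- (of_int (a j i) * t)))) * borel_transform ?c (L j)"
    by (simp only: geometric)
  finally have "?\<epsilon> * (\<Sum>k<?m. fps_exp (?c * ?s k)) * borel_transform ?c (L j) * (fps_exp t - fps_exp (- t))
      = - (fps_exp t * (fps_exp (of_int (a j i) * t) - fps_exp (- (of_int (a j i) * t)))) * borel_transform ?c (L j)" .
  then show "borel_transform ?c (L' i) * (fps_exp t - fps_exp (- t))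
    = borel_transform ?c (L i) * (fps_exp t - fps_exp (- t))
      - fps_exp t * (fps_exp (of_int (a j i) * t) - fps_exp (- (of_int (a j i) * t))) * borel_transform ?c (L j)"
    unfolding shifted by (simp only: distrib_right mult_minus_left diff_conv_add_uminus[symmetric])
  have borel_0: "borel_transform 0 F = fps_const (fps_nth F 1)" for F
    by (rule fps_ext) (auto simp: borel_transform_def)
  have "?\<epsilon> * of_nat ?m = - of_int (a j i)"
  proof (cases "i = j")
    case False
    then have "int ?m = - a j i"
      using a(2) by simp
    then have "of_int (int ?m) = (of_int (- a j i) :: complex fps)"
      by (simp only:)
    with False show ?thesis
      by simp
  qed (use a(1) in simp)
  with shifted[of 0] have "borel_transform 0 (L' i) = borel_transform 0 (L i) - of_int (a j i) * borel_transform 0 (L j)"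
    by simp
  then have "fps_nth (borel_transform 0 (L' i)) 0 = fps_nth (borel_transform 0 (L i) - of_int (a j i) * borel_transform 0 (L j)) 0"
    by (simp only:)
  then show "fps_nth (L' i) 1 = fps_nth (L i) 1 - of_int (a j i) * fps_nth (L j) 1"
    by (simp add: borel_0)
qed

section \<open>Intertwining and the main result\<close>

lemma hat_Phi_scalar:
  assumes "Y0_character \<psi>" "hbar \<noteq> 0"
  shows "fps_map \<psi> (Phi hbar d (U0_scalar c)) = q_series c"
  by (simp add: hat_Phi[OF assms] U0_eval_scalar ring_morphism_q_series)

lemma hat_Phi_K:
  assumes "Y0_character \<psi>" "hbar \<noteq> 0"
  shows "fps_map \<psi> (Phi hbar d (U0_K i n)) = fps_exp (of_int n * \<psi> (Y0_xi i 0) / 2)"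
  by (simp add: hat_Phi[OF assms] U0_eval_K ring_morphism_q_series signed_power_def fps_exp_power_mult)

lemma hat_Phi_h:
  assumes "Y0_character \<psi>" "hbar \<noteq> 0"
  shows "fps_map \<psi> (Phi hbar d (U0_h i r)) = Y0_character.h_value \<psi> hbar d i r"
  by (simp add: hat_Phi[OF assms] U0_eval_h ring_morphism_q_series)

lemma ring_morphism_hat_Phi:
  fixes \<psi> :: "'i::finite Y0 \<Rightarrow> complex"
  assumes "Y0_character \<psi>" "hbar \<noteq> 0"
  shows "ring_morphism (\<lambda>x. fps_map \<psi> (Phi hbar d x))"
  unfolding hat_Phi[OF assms]
  by (rule ring_morphism_U0_eval) (simp_all add: ring_morphism_q_series flip: fps_exp_add_mult)

text \<open>
  A character composed with the braid operator is again a character, so both sides become values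
  of \<open>\<Phi>\<close> at characters. On \<open>h\<^sub>i\<^sub>,\<^sub>r\<close> the symmetry
  $d_ia_{ij} = d_ja_{ji}$ turns the exponent $a_{ji}$ at $q_j$, from the braid operator, into
  $a_{ij}$ at $q_i$, from the quantum integers.
\<close>

theorem Phi_reflection:
  fixes a :: "'i::finite \<Rightarrow> 'i \<Rightarrow> int"
  assumes hbar: "hbar \<noteq> 0" and a: "a j j = 2" "\<And>i. i \<noteq> j \<Longrightarrow> a j i \<le> 0"
    and d: "\<And>i. d i > 0" and sym: "\<And>i. int (d i) * a i j = int (d j) * a j i"
  shows "Phi hbar d (U0_reflection a j (braid_coeff a d j) x) = Y0_braid_hat hbar a d j (Phi hbar d x)"
proof (rule Y0_series_eq_if_characters_eq)
  fix \<psi> :: "'i Y0 \<Rightarrow> complex" assume char: "Y0_character \<psi>"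
  interpret Y0_character \<psi> by fact
  let ?\<psi>' = "\<lambda>p. \<psi> (Y0_braid hbar a d j p)"
  have char': "Y0_character ?\<psi>'" by (rule Y0_character_braid)
  interpret B: Y0_character ?\<psi>' by (rule char')
  let ?T = "U0_reflection a j (braid_coeff a d j)"
  interpret T: U0_endomorphism ?T by (rule U0_endomorphism_reflection)
  note hom = ring_morphism_hat_Phi[OF char hbar, of d] ring_morphism_hat_Phi[OF char' hbar, of d]
  interpret P: ring_morphism "\<lambda>x. fps_map \<psi> (Phi hbar d x)" by (rule hom)
  interpret q: ring_morphism q_series by (rule ring_morphism_q_series)
  have "fps_map \<psi> (Phi hbar d (?T x)) = fps_map ?\<psi>' (Phi hbar d x)"
  proof (rule U0_hom_ext[where x = x])
    show "ring_morphism (\<lambda>x. fps_map \<psi> (Phi hbar d (?T x)))"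
      by (rule ring_morphism_comp[OF T.ring_morphism_axioms hom(1)])
    show "ring_morphism (\<lambda>x. fps_map ?\<psi>' (Phi hbar d x))"
      by (rule hom(2))
    show "fps_map \<psi> (Phi hbar d (?T (U0_scalar c))) = fps_map ?\<psi>' (Phi hbar d (U0_scalar c))" for c
      by (simp only: T.scalar hat_Phi_scalar[OF char hbar] hat_Phi_scalar[OF char' hbar])
    show "fps_map \<psi> (Phi hbar d (?T (U0_K i 1))) = fps_map ?\<psi>' (Phi hbar d (U0_K i 1))" for i
    proof -
      have "i \<noteq> j \<longrightarrow> a j i \<le> 0"
        using a(2) by blast
      then have "?\<psi>' (Y0_xi i 0) = \<psi> (Y0_xi i 0) - of_int (a j i) * \<psi> (Y0_xi j 0)"
        using borel_braid(2)[where a = a, OF hbar a(1), of i d]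
        by (simp only: xi_0[OF hbar] B.xi_0[OF hbar] diff_divide_distrib times_divide_eq_right)
      then show ?thesis
        by (simp only: reflection_K P.mult hat_Phi_K[OF char hbar] hat_Phi_K[OF char' hbar])
           (simp add: diff_divide_distrib flip: fps_exp_add_mult)
    qed
    show "fps_map \<psi> (Phi hbar d (?T (U0_h i r))) = fps_map ?\<psi>' (Phi hbar d (U0_h i r))" for i r
    proof -
      let ?r = "int_of_nzint r"
      define s where "s i = (of_int (int (d i) * ?r) / 2 :: complex)" for i
      define D where "D i = fps_exp (s i) - fps_exp (- s i)" for i
      define b where "b i = borel_transform (of_int ?r / hbar) (fps_log (fps_map \<psi> (xi_series hbar i)))" for i
      define b' where "b' i = borel_transform (of_int ?r / hbar) (fps_log (fps_map ?\<psi>' (xi_series hbar i)))" for i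
      let ?N = "fps_exp (s j) * (fps_exp (of_int (a j i) * s j) - fps_exp (- (of_int (a j i) * s j)))"
      have s: "s i \<noteq> 0" for i
        using d[of i] int_of_nzint[of r] by (simp add: s_def)
      have unit: "fps_X / D i * D i = fps_X" for i
        using quantum_unit(1)[OF s] by (simp add: D_def)
      have nonzero: "D i \<noteq> 0" for i
        using unit[of i] by auto
      have h_val: "h_value hbar d i r = fps_X / D i * b i" "B.h_value hbar d i r = fps_X / D i * b' i" for i
        by (simp_all add: h_value_def B.h_value_def Let_def D_def s_def b_def b'_def)
      have braid: "b' i * D j = b i * D j - ?N * b j"
        unfolding b_def b'_def D_def s_def by (rule borel_braid(1)[where a = a, OF hbar a(1)]) (use a(2) in blast)
      have coeff: "q_series (braid_coeff a d j i r) * D i = ?N"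
      proof -
        have "int (d i) * ?r \<noteq> 0"
          using d[of i] int_of_nzint[of r] by simp
        from qint_mult[OF this, of "a i j"]
        have qint: "q_series (qint (int (d i) * ?r) (a i j)) * D i
            = fps_exp (of_int (int (d i) * ?r * a i j) / 2) - fps_exp (- (of_int (int (d i) * ?r * a i j) / 2))"
          unfolding D_def s_def
          by (metis (no_types, lifting) q.mult q.diff q_series_qpow of_int_minus minus_divide_left)
        have "int (d i) * ?r * a i j = a j i * (int (d j) * ?r)"
          using sym[of i] by (simp add: mult_ac)
        then have exponent: "of_int (int (d i) * ?r * a i j) / 2 = of_int (a j i) * s j"
          by (simp only:) (simp add: s_def)
        have "q_series (braid_coeff a d j i r) * D i
            = fps_exp (s j) * (q_series (qint (int (d i) * ?r) (a i j)) * D i)"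
          by (simp only: braid_coeff_def q.mult q_series_qpow mult.assoc s_def[symmetric])
        then show ?thesis
          by (simp only: qint exponent)
      qed
      have expand: "(U * b i - c * (V * b j)) * (D i * D j) = (U * D i) * b i * D j - (c * D i) * (V * D j) * b j"
        for U V c
        by (simp add: algebra_simps)
      \<comment> \<open>The denominators \<open>D i\<close> and \<open>D j\<close> are cleared, and cancelled at the end.\<close>
      have "(h_value hbar d i r - q_series (braid_coeff a d j i r) * h_value hbar d j r) * (D i * D j)
          = fps_X * (b i * D j - ?N * b j)"
        unfolding h_val expand unit coeff by (simp add: algebra_simps)
      also have "\<dots> = B.h_value hbar d i r * (D i * D j)"
      proof -
        have "U * b' i * (D i * D j) = (U * D i) * (b' i * D j)" for U
          by (simp only: mult_ac)
        then show ?thesis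
          by (simp only: h_val unit braid)
      qed
      finally have "h_value hbar d i r - q_series (braid_coeff a d j i r) * h_value hbar d j r
          = B.h_value hbar d i r"
        using nonzero by simp
      then show ?thesis
        by (simp only: reflection_h P.diff P.mult hat_Phi_scalar[OF char hbar] hat_Phi_h[OF char hbar]
            hat_Phi_h[OF char' hbar])
    qed
  qed
  then show "fps_map \<psi> (Phi hbar d (?T x)) = fps_map \<psi> (Y0_braid_hat hbar a d j (Phi hbar d x))"
    by (simp add: Y0_braid_hat_def fps_map_def)
qed

lemma K_root_simple_reflection:
  "U0_K_root (simple_reflection a j (simple_root i)) = U0_K i 1 * U0_K j (- a j i)"
proof -
  have "(\<Sum>l\<in>UNIV. Poly_Mapping.lookup (simple_root i) l * a j l) = a j i"
    by (simp add: simple_root_def lookup_single when_def mult_delta_left)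
  then have "simple_reflection a j (simple_root i) = Poly_Mapping.single i 1 + Poly_Mapping.single j (- a j i)"
    by (simp add: simple_reflection_def simple_root_def single_uminus)
  moreover have "U0_K_root \<beta> = Poly_Mapping.single (\<beta>, 0) 1" for \<beta>
    using U0_mon_eval_generators[of "(\<beta>, 0)"]
    by (simp add: U0_K_root_def U0_mon_eval_def exponent_eval_0 signed_power_U0_K_1)
  ultimately show ?thesis
    by (simp add: U0_K_def mult_single)
qed

theorem proposition6p7:
  fixes a :: "'i::finite \<Rightarrow> 'i \<Rightarrow> int"
    and d :: "'i \<Rightarrow> nat"
    and hbar :: complex
    and j :: 'i
  assumes "simple_cartan_matrix a"
    and "minimal_symmetrizer a d"
    and "hbar \<noteq> 0"
  shows "(\<exists>!T. U0_hopf_automorphism T \<and> Phi hbar d \<circ> T = Y0_braid_hat hbar a d j \<circ> Phi hbar d) \<and>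
    (\<forall>T. U0_hopf_automorphism T \<and> Phi hbar d \<circ> T = Y0_braid_hat hbar a d j \<circ> Phi hbar d \<longrightarrow>
       (\<forall>i. T (U0_K i 1) = U0_K_root (simple_reflection a j (simple_root i)) \<and>
            U0_K_root (simple_reflection a j (simple_root i)) = U0_K i 1 * U0_K j (- a j i)) \<and>
       (\<forall>i r. T (U0_h i r) =
            U0_h i r -
            U0_scalar (qpow (int (d j) * int_of_nzint r) *
              exact_quot (qint (int (d i)) (int_of_nzint r * a i j)) (qint (int (d i)) (int_of_nzint r))) *
            U0_h j r))"
proof -
  have a: "a j j = 2" "\<And>i. i \<noteq> j \<Longrightarrow> a j i \<le> 0"
    using assms(1) by (auto simp: simple_cartan_matrix_def)
  have d: "\<And>i. d i > 0" and sym: "\<And>i. int (d i) * a i j = int (d j) * a j i"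
    using assms(2) by (auto simp: minimal_symmetrizer_def symmetrizer_def)
  let ?R = "U0_reflection a j (braid_coeff a d j)"
  let ?P = "\<lambda>T. U0_hopf_automorphism T \<and> Phi hbar d \<circ> T = Y0_braid_hat hbar a d j \<circ> Phi hbar d"
  have R: "?P ?R"
    using reflection_hopf[OF bij_braid_reflection[of a j d, OF a(1) d]] Phi_reflection[where d = d, OF assms(3) a d sym]
    by (simp add: fun_eq_iff)
  have unique: "T = ?R" if "?P T" for T
  proof
    fix x
    have "Phi hbar d (T x) = Phi hbar d (?R x)"
      using that R by (metis comp_apply)
    then show "T x = ?R x"
      by (rule injD[OF inj_Phi[where d = d, OF assms(3) d]])
  qed
  have "exact_quot (qint (int (d i)) (int_of_nzint r * a i j)) (qint (int (d i)) (int_of_nzint r))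
      = qint (int (d i) * int_of_nzint r) (a i j)" for i r
    using exact_quot_qint[of "int (d i)" "int_of_nzint r" "a i j"] d[of i] int_of_nzint[of r] by simp
  then have formulas: "?R (U0_K i 1) = U0_K i 1 * U0_K j (- a j i)"
    "?R (U0_h i r) = U0_h i r - U0_scalar (qpow (int (d j) * int_of_nzint r) *
              exact_quot (qint (int (d i)) (int_of_nzint r * a i j)) (qint (int (d i)) (int_of_nzint r))) *
            U0_h j r" for i r
    by (simp_all add: reflection_K reflection_h braid_coeff_def)
  show ?thesis
    using R unique formulas K_root_simple_reflection by metis
qed

end
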